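(* If $M$ satisfies (SA), then $T=\mathrm{Th}(M)$ is supersimple.
   Context: Setting: $L$ is a countable first-order language and $\mathcal C$ an infinite class of finite $L$-structures. Let $L^+$ be the two-sorted language with a sort $\mathbf D$ carrying $L$, a sort $\mathbf{OF}$ carrying the language of ordered fields with $\log$, and for each $L$-formula $\phi(\bar x,\bar y)$ ($|\bar x|=r$, $|\bar y|=s$) a function symbol $f_\phi:\mathbf D^s\to\mathbf{OF}$; each $N\in\mathcal C$ becomes an $L^+$-structure with $\mathbf{OF}$-sort the real field with $\log$ and $f_\phi(\bar a)=|\phi(N^r,\bar a)|$. $K^*$ is an ultraproduct of these over a non-principal ultrafilter, with $\mathbf{OF}$-sort a non-archimedean real closed field $\mathbb R^*$; $M$ is the $L$-structure on the $\mathbf D$-sort, $T=\mathrm{Th}(M)$. For definable $X=\phi(M^r,\bar a)$, $|X|=f_\phi(\bar a)$; with $C$ the convex hull of $\mathbb Z$ in $\mathbb R^*$, $\delta(X)=\log|X|+C\in\mathbb R^*/C$; for a partial type $X$, $\delta(X)=\inf\{\delta(D):D\supseteq X\text{ definable}\}$ in the semigroup of cuts of $\mathbb R^*/C$. (SA): for every partial type $p(\bar x)$ over a parameter set in $M$ there is a finite subset $p_0\subseteq p$ with $\delta(p)=\delta(p_0)$. *)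

theory Defs
  imports Complex_Main "HOL-Library.FuncSet" "HOL-Library.Equipollence"
begin

section \<open>First-order logic\<close>

record ('f, 'r) language =
  funs :: "'f set"
  rels :: "'r set"
  farity :: "'f \<Rightarrow> nat"
  rarity :: "'r \<Rightarrow> nat"

definition countable_language :: "('f, 'r) language \<Rightarrow> bool" where
  "countable_language L \<longleftrightarrow> countable (funs L) \<and> countable (rels L)"

record ('f, 'r, 'a) fostruct =
  univ :: "'a set"
  fn :: "'f \<Rightarrow> 'a list \<Rightarrow> 'a"
  rl :: "'r \<Rightarrow> 'a list \<Rightarrow> bool"

definition is_structure :: "('f, 'r) language \<Rightarrow> ('f, 'r, 'a) fostruct \<Rightarrow> bool" where
  "is_structure L N \<longleftrightarrow> univ N \<noteq> {} \<and>
     (\<forall>f\<in>funs L. \<forall>xs. length xs = farity L f \<and> set xs \<subseteq> univ N \<longrightarrow> fn N f xs \<in> univ N)"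

datatype 'f tm = Var nat | Fn 'f "'f tm list"

datatype ('f, 'r) fm =
    Eq "'f tm" "'f tm"
  | Rel 'r "'f tm list"
  | Neg "('f, 'r) fm"
  | Conj "('f, 'r) fm" "('f, 'r) fm"
  | Exists nat "('f, 'r) fm"

fun wf_tm :: "('f, 'r) language \<Rightarrow> 'f tm \<Rightarrow> bool" where
  "wf_tm L (Var i) = True"
| "wf_tm L (Fn f ts) = (f \<in> funs L \<and> length ts = farity L f \<and> (\<forall>t\<in>set ts. wf_tm L t))"

fun wf_fm :: "('f, 'r) language \<Rightarrow> ('f, 'r) fm \<Rightarrow> bool" where
  "wf_fm L (Eq s t) = (wf_tm L s \<and> wf_tm L t)"
| "wf_fm L (Rel R ts) = (R \<in> rels L \<and> length ts = rarity L R \<and> (\<forall>t\<in>set ts. wf_tm L t))"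
| "wf_fm L (Neg \<phi>) = wf_fm L \<phi>"
| "wf_fm L (Conj \<phi> \<psi>) = (wf_fm L \<phi> \<and> wf_fm L \<psi>)"
| "wf_fm L (Exists i \<phi>) = wf_fm L \<phi>"

fun fv_tm :: "'f tm \<Rightarrow> nat set" where
  "fv_tm (Var i) = {i}"
| "fv_tm (Fn f ts) = (\<Union>t\<in>set ts. fv_tm t)"

fun fv :: "('f, 'r) fm \<Rightarrow> nat set" where
  "fv (Eq s t) = fv_tm s \<union> fv_tm t"
| "fv (Rel R ts) = (\<Union>t\<in>set ts. fv_tm t)"
| "fv (Neg \<phi>) = fv \<phi>"
| "fv (Conj \<phi> \<psi>) = fv \<phi> \<union> fv \<psi>"
| "fv (Exists i \<phi>) = fv \<phi> - {i}"

fun val :: "('f, 'r, 'a) fostruct \<Rightarrow> (nat \<Rightarrow> 'a) \<Rightarrow> 'f tm \<Rightarrow> 'a" where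
  "val N e (Var i) = e i"
| "val N e (Fn f ts) = fn N f (map (val N e) ts)"

fun sat :: "('f, 'r, 'a) fostruct \<Rightarrow> (nat \<Rightarrow> 'a) \<Rightarrow> ('f, 'r) fm \<Rightarrow> bool" where
  "sat N e (Eq s t) = (val N e s = val N e t)"
| "sat N e (Rel R ts) = rl N R (map (val N e) ts)"
| "sat N e (Neg \<phi>) = (\<not> sat N e \<phi>)"
| "sat N e (Conj \<phi> \<psi>) = (sat N e \<phi> \<and> sat N e \<psi>)"
| "sat N e (Exists i \<phi>) = (\<exists>a\<in>univ N. sat N (e(i := a)) \<phi>)"

definition Th :: "('f, 'r) language \<Rightarrow> ('f, 'r, 'a) fostruct \<Rightarrow> ('f, 'r) fm set" where
  "Th L N = {\<sigma>. wf_fm L \<sigma> \<and> fv \<sigma> = {} \<and> (\<forall>e. sat N e \<sigma>)}"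

definition models :: "('f, 'r) language \<Rightarrow> ('f, 'r, 'a) fostruct \<Rightarrow> ('f, 'r) fm set \<Rightarrow> bool" where
  "models L N T \<longleftrightarrow> is_structure L N \<and> (\<forall>\<sigma>\<in>T. \<forall>e. sat N e \<sigma>)"


section \<open>Formulas with parameters and types\<close>

definition tuples :: "('f, 'r, 'a) fostruct \<Rightarrow> nat \<Rightarrow> 'a list set" where
  "tuples N r = {xs. length xs = r \<and> set xs \<subseteq> univ N}"

text \<open>A formula \<open>\<phi>(x\<^sub>0, \<dots>, x\<^sub>r\<^sub>-\<^sub>1; a)\<close> with parameters is a pair of a formula and a parameter
  tuple: variables \<open>0, \<dots>, r - 1\<close> are the object variables, and variable \<open>r + j\<close> is
  interpreted by the \<open>j\<close>-th entry of the parameter tuple.\<close>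

type_synonym ('f, 'r, 'a) pfm = "('f, 'r) fm \<times> 'a list"

definition pformulas :: "('f, 'r) language \<Rightarrow> 'a set \<Rightarrow> nat \<Rightarrow> ('f, 'r, 'a) pfm set" where
  "pformulas L B r = {(\<phi>, as). wf_fm L \<phi> \<and> set as \<subseteq> B \<and> fv \<phi> \<subseteq> {..<r + length as}}"

definition solset :: "('f, 'r, 'a) fostruct \<Rightarrow> nat \<Rightarrow> ('f, 'r, 'a) pfm \<Rightarrow> 'a list set" where
  "solset N r = (\<lambda>(\<phi>, as). {xs \<in> tuples N r. sat N ((!) (xs @ as)) \<phi>})"

definition realizations ::
    "('f, 'r, 'a) fostruct \<Rightarrow> nat \<Rightarrow> ('f, 'r, 'a) pfm set \<Rightarrow> 'a list set" where
  "realizations N r p = {xs \<in> tuples N r. \<forall>\<phi>\<in>p. xs \<in> solset N r \<phi>}"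

definition partial_type :: "('f, 'r) language \<Rightarrow> ('f, 'r, 'a) fostruct \<Rightarrow> 'a set \<Rightarrow> nat
    \<Rightarrow> ('f, 'r, 'a) pfm set \<Rightarrow> bool" where
  "partial_type L N B r p \<longleftrightarrow> p \<subseteq> pformulas L B r \<and>
     (\<forall>q. finite q \<and> q \<subseteq> p \<longrightarrow> realizations N r q \<noteq> {})"

definition complete_type :: "('f, 'r) language \<Rightarrow> ('f, 'r, 'a) fostruct \<Rightarrow> 'a set \<Rightarrow> nat
    \<Rightarrow> ('f, 'r, 'a) pfm set \<Rightarrow> bool" where
  "complete_type L N B r p \<longleftrightarrow> partial_type L N B r p \<and>
     (\<forall>(\<phi>, as) \<in> pformulas L B r. (\<phi>, as) \<in> p \<or> (Neg \<phi>, as) \<in> p)"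

text \<open>Consequence of a type modulo the elementary diagram of \<open>N\<close>, where \<open>S\<close> is a set definable
  over \<open>N\<close>. A derivation uses finitely many formulas of \<open>p\<close>. For a type \<open>p\<close> not realized
  in \<open>N\<close> this differs from inclusion of the solution set of \<open>p\<close> in \<open>N\<close>;
  it is inclusion in all elementary extensions of \<open>N\<close>.\<close>

definition entails :: "('f, 'r, 'a) fostruct \<Rightarrow> nat \<Rightarrow> ('f, 'r, 'a) pfm set \<Rightarrow> 'a list set \<Rightarrow> bool" where
  "entails N r p S \<longleftrightarrow> (\<exists>q. finite q \<and> q \<subseteq> p \<and> realizations N r q \<subseteq> S)"

definition tp :: "('f, 'r) language \<Rightarrow> ('f, 'r, 'a) fostruct \<Rightarrow> 'a set \<Rightarrow> 'a list
    \<Rightarrow> ('f, 'r, 'a) pfm set" where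
  "tp L N A b = {\<phi> \<in> pformulas L A (length b). b \<in> solset N (length b) \<phi>}"


section \<open>Forking and supersimplicity\<close>

text \<open>\<open>saturated_for L N B\<close> is \<open>\<kappa>\<close>-saturation for \<open>\<kappa> = (|B| + |L| + \<aleph>\<^sub>0)\<^sup>+\<close>; thus \<open>N\<close> serves as a
  monster model in which \<open>B\<close> is small, and dividing and forking over subsets of \<open>B\<close> may
  be computed inside \<open>N\<close>.\<close>

definition saturated_for :: "('f, 'r) language \<Rightarrow> ('f, 'r, 'a) fostruct \<Rightarrow> 'a set \<Rightarrow> bool" where
  "saturated_for L N B \<longleftrightarrow>
     (\<forall>A n p. A \<subseteq> univ N \<and> A \<lesssim> B <+> {\<phi>. wf_fm L \<phi>} \<and> partial_type L N A n p
        \<longrightarrow> realizations N n p \<noteq> {})"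

definition divides :: "('f, 'r) language \<Rightarrow> ('f, 'r, 'a) fostruct \<Rightarrow> 'a set \<Rightarrow> nat
    \<Rightarrow> ('f, 'r, 'a) pfm \<Rightarrow> bool" where
  "divides L N A n = (\<lambda>(\<phi>, b).
     \<exists>k>0. \<exists>c :: nat \<Rightarrow> 'a list.
       (\<forall>i. c i \<in> tuples N (length b) \<and> tp L N A (c i) = tp L N A b) \<and>
       (\<forall>I. finite I \<and> card I = k \<longrightarrow> realizations N n ((\<lambda>i. (\<phi>, c i)) ` I) = {}))"

definition forks :: "('f, 'r) language \<Rightarrow> ('f, 'r, 'a) fostruct \<Rightarrow> 'a set \<Rightarrow> nat
    \<Rightarrow> ('f, 'r, 'a) pfm set \<Rightarrow> bool" where
  "forks L N A n p \<longleftrightarrow>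
     (\<exists>\<Psi>. finite \<Psi> \<and> \<Psi> \<subseteq> pformulas L (univ N) n \<and> (\<forall>\<psi>\<in>\<Psi>. divides L N A n \<psi>) \<and>
        entails N n p (\<Union>\<psi>\<in>\<Psi>. solset N n \<psi>))"

text \<open>Every complete type, in finitely many variables, does not fork over some finite subset of its
  domain. HOL cannot quantify over types inside a formula, so the type \<open>'b\<close> from which the
  elements of the models are drawn is an argument; a theory is supersimple if this holds for every
  type \<open>'b\<close>.\<close>

definition supersimple :: "('f, 'r) language \<Rightarrow> ('f, 'r) fm set \<Rightarrow> 'b itself \<Rightarrow> bool" where
  "supersimple L T _ \<longleftrightarrow>
     (\<forall>(N :: ('f, 'r, 'b) fostruct) B n p.
        models L N T \<and> B \<subseteq> univ N \<and> saturated_for L N B \<and> complete_type L N B n p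
        \<longrightarrow> (\<exists>A. finite A \<and> A \<subseteq> B \<and> \<not> forks L N A n p))"


section \<open>Ultraproducts\<close>

text \<open>An ultrafilter on the set \<open>C\<close> is represented by the filter on the ambient type that it
  generates.\<close>

definition ultrafilter_on :: "'i set \<Rightarrow> 'i filter \<Rightarrow> bool" where
  "ultrafilter_on C U \<longleftrightarrow> U \<noteq> bot \<and> eventually (\<lambda>i. i \<in> C) U \<and>
     (\<forall>P. eventually P U \<or> eventually (\<lambda>i. \<not> P i) U)"

definition nonprincipal_on :: "'i set \<Rightarrow> 'i filter \<Rightarrow> bool" where
  "nonprincipal_on C U \<longleftrightarrow> (\<forall>i\<in>C. \<not> eventually (\<lambda>j. j = i) U)"

definition uclass :: "'i set \<Rightarrow> 'i filter \<Rightarrow> ('i \<Rightarrow> 'x set) \<Rightarrow> ('i \<Rightarrow> 'x) \<Rightarrow> ('i \<Rightarrow> 'x) set" where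
  "uclass C U X x = {y \<in> Pi\<^sub>E C X. eventually (\<lambda>i. y i = x i) U}"

definition uprod :: "'i set \<Rightarrow> 'i filter \<Rightarrow> ('i \<Rightarrow> 'x set) \<Rightarrow> ('i \<Rightarrow> 'x) set set" where
  "uprod C U X = uclass C U X ` Pi\<^sub>E C X"

definition urep :: "('i \<Rightarrow> 'x) set \<Rightarrow> 'i \<Rightarrow> 'x" where
  "urep c = (SOME x. x \<in> c)"

type_synonym ('f, 'r, 'a) uelem = "(('f, 'r, 'a) fostruct \<Rightarrow> 'a) set"

type_synonym ('f, 'r, 'a) hyper = "(('f, 'r, 'a) fostruct \<Rightarrow> real) set"

text \<open>The \<open>\<^bold>D\<close>-sort of \<open>K\<^sup>*\<close>, i.e. the structure \<open>M\<close>.\<close>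

definition ultraproduct :: "('f, 'r, 'a) fostruct set \<Rightarrow> ('f, 'r, 'a) fostruct filter
    \<Rightarrow> ('f, 'r, ('f, 'r, 'a) uelem) fostruct" where
  "ultraproduct C U =
     \<lparr> univ = uprod C U univ,
       fn = (\<lambda>f cs. uclass C U univ (\<lambda>N. fn N f (map (\<lambda>c. urep c N) cs))),
       rl = (\<lambda>R cs. eventually (\<lambda>N. rl N R (map (\<lambda>c. urep c N) cs)) U) \<rparr>"

text \<open>The \<open>\<^bold>O\<^bold>F\<close>-sort of \<open>K\<^sup>*\<close>, i.e. the ultrapower \<open>\<real>\<^sup>*\<close> of the reals.\<close>

abbreviation hclass where
  "hclass C U \<equiv> uclass C U (\<lambda>_. UNIV :: real set)"

definition hyperreals :: "('f, 'r, 'a) fostruct set \<Rightarrow> ('f, 'r, 'a) fostruct filter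
    \<Rightarrow> ('f, 'r, 'a) hyper set" where
  "hyperreals C U = uprod C U (\<lambda>_. UNIV)"

definition hle :: "('f, 'r, 'a) fostruct filter
    \<Rightarrow> ('f, 'r, 'a) hyper \<Rightarrow> ('f, 'r, 'a) hyper \<Rightarrow> bool" where
  "hle U a b \<longleftrightarrow> eventually (\<lambda>N. urep a N \<le> urep b N) U"

definition hadd :: "('f, 'r, 'a) fostruct set \<Rightarrow> ('f, 'r, 'a) fostruct filter
    \<Rightarrow> ('f, 'r, 'a) hyper \<Rightarrow> ('f, 'r, 'a) hyper \<Rightarrow> ('f, 'r, 'a) hyper" where
  "hadd C U a b = hclass C U (\<lambda>N. urep a N + urep b N)"

definition hlog :: "('f, 'r, 'a) fostruct set \<Rightarrow> ('f, 'r, 'a) fostruct filter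
    \<Rightarrow> ('f, 'r, 'a) hyper \<Rightarrow> ('f, 'r, 'a) hyper" where
  "hlog C U a = hclass C U (\<lambda>N. ln (urep a N))"

definition hint :: "('f, 'r, 'a) fostruct set \<Rightarrow> ('f, 'r, 'a) fostruct filter
    \<Rightarrow> int \<Rightarrow> ('f, 'r, 'a) hyper" where
  "hint C U k = hclass C U (\<lambda>_. of_int k)"

text \<open>The interpretation in \<open>K\<^sup>*\<close> of the function symbol \<open>f\<^sub>\<phi>\<close>, where \<open>r\<close> is the length of the
  tuple of object variables, at the parameter tuple \<open>as\<close>.\<close>

definition fcard :: "('f, 'r, 'a) fostruct set \<Rightarrow> ('f, 'r, 'a) fostruct filter \<Rightarrow> nat
    \<Rightarrow> ('f, 'r) fm \<Rightarrow> ('f, 'r, 'a) uelem list \<Rightarrow> ('f, 'r, 'a) hyper" where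
  "fcard C U r \<phi> as =
     hclass C U (\<lambda>N. real (card (solset N r (\<phi>, map (\<lambda>c. urep c N) as))))"


section \<open>Pseudofinite dimension\<close>

definition conv_int :: "('f, 'r, 'a) fostruct set \<Rightarrow> ('f, 'r, 'a) fostruct filter
    \<Rightarrow> ('f, 'r, 'a) hyper set" where
  "conv_int C U =
     {x \<in> hyperreals C U. \<exists>m n. hle U (hint C U m) x \<and> hle U x (hint C U n)}"

definition hcoset :: "('f, 'r, 'a) fostruct set \<Rightarrow> ('f, 'r, 'a) fostruct filter
    \<Rightarrow> ('f, 'r, 'a) hyper \<Rightarrow> ('f, 'r, 'a) hyper set" where
  "hcoset C U x = hadd C U x ` conv_int C U"

definition hquot :: "('f, 'r, 'a) fostruct set \<Rightarrow> ('f, 'r, 'a) fostruct filter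
    \<Rightarrow> ('f, 'r, 'a) hyper set set" where
  "hquot C U = hcoset C U ` hyperreals C U"

definition qle :: "('f, 'r, 'a) fostruct filter
    \<Rightarrow> ('f, 'r, 'a) hyper set \<Rightarrow> ('f, 'r, 'a) hyper set \<Rightarrow> bool" where
  "qle U v w \<longleftrightarrow> (\<exists>x\<in>v. \<exists>y\<in>w. hle U x y)"

text \<open>Cuts are the downward closed subsets of the quotient; an element \<open>v\<close> is identified with the
  cut of all elements below or equal to \<open>v\<close>, and the infimum of a set of cuts is its intersection.\<close>

definition cut_of :: "('f, 'r, 'a) fostruct set \<Rightarrow> ('f, 'r, 'a) fostruct filter
    \<Rightarrow> ('f, 'r, 'a) hyper set \<Rightarrow> ('f, 'r, 'a) hyper set set" where
  "cut_of C U v = {w \<in> hquot C U. qle U w v}"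

text \<open>The empty cut plays the role of \<open>-\<infinity>\<close>, the dimension of the empty set; without the case
  distinction the convention \<open>ln 0 = 0\<close> would make it \<open>0\<close>.\<close>

definition delta :: "('f, 'r, 'a) fostruct set \<Rightarrow> ('f, 'r, 'a) fostruct filter \<Rightarrow> nat
    \<Rightarrow> ('f, 'r, ('f, 'r, 'a) uelem) pfm \<Rightarrow> ('f, 'r, 'a) hyper set set" where
  "delta C U r = (\<lambda>(\<phi>, as).
     if fcard C U r \<phi> as = hint C U 0 then {}
     else cut_of C U (hcoset C U (hlog C U (fcard C U r \<phi> as))))"

definition delta_type :: "('f, 'r) language \<Rightarrow> ('f, 'r, 'a) fostruct set
    \<Rightarrow> ('f, 'r, 'a) fostruct filter \<Rightarrow> nat
    \<Rightarrow> ('f, 'r, ('f, 'r, 'a) uelem) pfm set \<Rightarrow> ('f, 'r, 'a) hyper set set" where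
  "delta_type L C U r p =
     (let M = ultraproduct C U in
      \<Inter>{delta C U r D | D. D \<in> pformulas L (univ M) r \<and> entails M r p (solset M r D)})"

definition SA :: "('f, 'r) language \<Rightarrow> ('f, 'r, 'a) fostruct set
    \<Rightarrow> ('f, 'r, 'a) fostruct filter \<Rightarrow> bool" where
  "SA L C U \<longleftrightarrow>
     (\<forall>B r p. B \<subseteq> univ (ultraproduct C U) \<and> partial_type L (ultraproduct C U) B r p \<longrightarrow>
        (\<exists>p\<^sub>0. finite p\<^sub>0 \<and> p\<^sub>0 \<subseteq> p \<and> delta_type L C U r p = delta_type L C U r p\<^sub>0))"

end

(* In an omega-saturated model of T define the D-rank using the finitary form fdiv of dividing.  If the
   rank of x = x is an ordinal, then a complete type that forks over every finite subset of its
   domain gives an infinite descending sequence of ranks: rank is subadditive on unions and depends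
   only on the type of the parameters, so each forking step drops it.  If the rank of x = x is
   infinite, there is an infinite chain of formulas, each obtained from the previous one by adding
   an instance that divides over the parameters used so far.  In M the chain is rebuilt with
   parameters of the same type, chosen such that every step lowers delta: among m members of
   a k-inconsistent family some member meets at most k/m of a given finite set, and all these
   conditions together are met in the ultraproduct by saturation.  The resulting partial type
   contradicts (SA).  Only D-rank comparisons occur in the argument, so ordinals are replaced by
   transfinite iteration of an operator on families of definable sets. *)

theory Submission
  imports Defs "HOL-Library.Countable_Set"
begin

section \<open>Formulas\<close>

text \<open>Three structures must communicate: the saturated model \<open>N\<close> where forking is
  defined, the ultraproduct \<open>M\<close>, and its finite factors, the only place where sets can
  be counted. Only first-order statements pass between them. An infinite sequence witnessing
  dividing is not one, but for fixed \<open>\<chi>\<close>, \<open>k\<close>, \<open>m\<close> the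
  existence of \<open>m\<close> tuples satisfying \<open>\<chi>\<close> with k-inconsistent
  instances is (\<open>witness_formula\<close>); hence \<open>fdiv\<close>.

  A rank is interposed because forking yields a disjunction of given dividing instances, whereas
  counting bounds only some member of a family, so it controls a well chosen conjugate and not the
  given instance. The rank absorbs disjunctions by subadditivity and changes of conjugate by its
  invariance under equality of types.

  \<open>delta\<close> has no such invariance: it is read off the finite factors, and tuples of the
  same type may cut out sets of different dimension. Hence a chain found in \<open>N\<close> cannot
  simply be copied; each new tuple in \<open>M\<close> is chosen for its type and for the drop
  simultaneously. The drop has to beat every finite factor because \<open>delta\<close> ignores
  summands from the convex hull of the integers.\<close>

lemma val_cong:
  assumes "\<And>v. v \<in> fv_tm t \<Longrightarrow> e v = e' v"
  shows "val N e t = val N e' t"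
  using assms
proof (induction t)
  case (Fn f ts)
  then have "map (val N e) ts = map (val N e') ts" by auto
  then show ?case by (simp only: val.simps)
qed simp

lemma sat_cong:
  assumes "\<And>v. v \<in> fv \<phi> \<Longrightarrow> e v = e' v"
  shows "sat N e \<phi> = sat N e' \<phi>"
  using assms
proof (induction \<phi> arbitrary: e e')
  case (Eq s t)
  then have "val N e s = val N e' s" "val N e t = val N e' t" by (auto intro!: val_cong)
  then show ?case by simp
next
  case (Rel R ts)
  then have "map (val N e) ts = map (val N e') ts" by (auto intro!: val_cong)
  then show ?case by (simp only: sat.simps)
next
  case (Neg \<phi>)
  have "sat N e \<phi> = sat N e' \<phi>" using Neg.prems by (intro Neg.IH) auto
  then show ?case by simp
next
  case (Conj \<phi> \<psi>)
  have "sat N e \<phi> = sat N e' \<phi>" "sat N e \<psi> = sat N e' \<psi>"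
    using Conj.prems by (auto intro!: Conj.IH)
  then show ?case by simp
next
  case (Exists i \<phi>)
  have "sat N (e(i := a)) \<phi> = sat N (e'(i := a)) \<phi>" for a
    using Exists.prems by (intro Exists.IH) auto
  then show ?case by simp
qed

definition formulas :: "('f, 'r) language \<Rightarrow> nat \<Rightarrow> ('f, 'r) fm set" where
  "formulas L l = {\<phi>. wf_fm L \<phi> \<and> fv \<phi> \<subseteq> {..<l}}"

lemma formulas_mono: "l \<le> l' \<Longrightarrow> formulas L l \<subseteq> formulas L l'"
  by (auto simp: formulas_def)

lemma formulas_mono': "\<phi> \<in> formulas L l \<Longrightarrow> l \<le> l' \<Longrightarrow> \<phi> \<in> formulas L l'"
  using formulas_mono by blast

lemma formulas_simps [simp]:
  "Neg \<phi> \<in> formulas L l \<longleftrightarrow> \<phi> \<in> formulas L l"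
  "Conj \<phi> \<psi> \<in> formulas L l \<longleftrightarrow> \<phi> \<in> formulas L l \<and> \<psi> \<in> formulas L l"
  by (auto simp: formulas_def)

lemma pformulas_iff: "(\<phi>, as) \<in> pformulas L B r \<longleftrightarrow> set as \<subseteq> B \<and> \<phi> \<in> formulas L (r + length as)"
  by (auto simp: pformulas_def formulas_def)

lemma sat_agree:
  assumes "\<phi> \<in> formulas L l" "\<And>v. v < l \<Longrightarrow> e v = e' v"
  shows "sat N e \<phi> = sat N e' \<phi>"
  using assms by (intro sat_cong) (auto simp: formulas_def)

lemma sat_append:
  assumes "\<phi> \<in> formulas L l" "length as = l"
  shows "sat N ((!) (as @ bs)) \<phi> = sat N ((!) as) \<phi>"
  using assms by (intro sat_agree[where l = l]) (auto simp: nth_append)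

section \<open>Operations on formulas: renaming, gaps for parameters, block quantifiers, finite
  conjunctions\<close>

fun rename_tm :: "(nat \<Rightarrow> nat) \<Rightarrow> 'f tm \<Rightarrow> 'f tm" where
  "rename_tm f (Var i) = Var (f i)"
| "rename_tm f (Fn g ts) = Fn g (map (rename_tm f) ts)"

text \<open>Bound variables are renamed along with the free ones, so injectivity is what prevents
  capture. Every renaming used below is therefore an injection of all of \<open>nat\<close>, even
  where only finitely many variables matter.\<close>

fun rename :: "(nat \<Rightarrow> nat) \<Rightarrow> ('f, 'r) fm \<Rightarrow> ('f, 'r) fm" where
  "rename f (Eq s t) = Eq (rename_tm f s) (rename_tm f t)"
| "rename f (Rel R ts) = Rel R (map (rename_tm f) ts)"
| "rename f (Neg \<phi>) = Neg (rename f \<phi>)"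
| "rename f (Conj \<phi> \<psi>) = Conj (rename f \<phi>) (rename f \<psi>)"
| "rename f (Exists i \<phi>) = Exists (f i) (rename f \<phi>)"

lemma wf_rename_tm [simp]: "wf_tm L (rename_tm f t) = wf_tm L t"
  by (induction t) auto

lemma wf_rename [simp]: "wf_fm L (rename f \<phi>) = wf_fm L \<phi>"
  by (induction \<phi>) auto

lemma fv_rename_tm [simp]: "fv_tm (rename_tm f t) = f ` fv_tm t"
  by (induction t) auto

lemma fv_rename: "inj f \<Longrightarrow> fv (rename f \<phi>) = f ` fv \<phi>"
  by (induction \<phi>) (auto simp: image_set_diff)

lemma val_rename [simp]: "val N e (rename_tm f t) = val N (e \<circ> f) t"
  by (induction t) (auto simp: comp_def cong: map_cong)

lemma sat_rename:
  assumes "inj f"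
  shows "sat N e (rename f \<phi>) = sat N (e \<circ> f) \<phi>"
proof (induction \<phi> arbitrary: e)
  case (Exists i \<phi>)
  have "e(f i := a) \<circ> f = (e \<circ> f)(i := a)" for a
    using assms by (auto simp: fun_eq_iff inj_eq)
  then show ?case by (simp only: rename.simps sat.simps Exists.IH)
qed (auto simp: comp_def)

lemma rename_formulas:
  assumes "\<phi> \<in> formulas L l" "inj f" "\<And>v. v < l \<Longrightarrow> f v < l'"
  shows "rename f \<phi> \<in> formulas L l'"
  using assms by (auto simp: formulas_def fv_rename)

lemma sat_rename_agree:
  assumes "\<phi> \<in> formulas L l" "inj f" "\<And>v. v < l \<Longrightarrow> e (f v) = e' v"
  shows "sat N e (rename f \<phi>) = sat N e' \<phi>"
  using assms by (auto simp: sat_rename intro!: sat_agree[where l = l])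

text \<open>Parameter tuples will grow on the left, from \<open>as\<close> to \<open>c @ as\<close>.
  The gap behind the \<open>n\<close> object variables makes room for \<open>c\<close>.\<close>

definition lift :: "nat \<Rightarrow> nat \<Rightarrow> ('f, 'r) fm \<Rightarrow> ('f, 'r) fm" where
  "lift n s = rename (\<lambda>v. if v < n then v else v + s)"

lemma inj_lift: "inj (\<lambda>v :: nat. if v < n then v else v + s)"
  by (auto simp: inj_def)

lemma lift_formulas: "\<phi> \<in> formulas L (n + l) \<Longrightarrow> l' = n + s + l \<Longrightarrow> lift n s \<phi> \<in> formulas L l'"
  unfolding lift_def by (rule rename_formulas[OF _ inj_lift]) auto

lemma sat_lift:
  assumes "\<phi> \<in> formulas L (length xs + length as)"
  shows "sat N ((!) (xs @ cs @ as)) (lift (length xs) (length cs) \<phi>) = sat N ((!) (xs @ as)) \<phi>"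
  unfolding lift_def
  by (rule sat_rename_agree[OF assms inj_lift]) (auto simp: nth_append)

text \<open>The renaming is the cyclic permutation of \<open>0, ..., l\<close> that sends the
  variable to be quantified to the last place and moves the others down by one, so it stays
  injective.\<close>

definition ex1 :: "nat \<Rightarrow> ('f, 'r) fm \<Rightarrow> ('f, 'r) fm" where
  "ex1 l \<phi> = Exists l (rename (\<lambda>v. if v = 0 then l else if v \<le> l then v - 1 else v) \<phi>)"

lemma inj_ex1: "inj (\<lambda>v :: nat. if v = 0 then l else if v \<le> l then v - 1 else v)"
  by (auto simp: inj_def)

lemma ex1_formulas:
  assumes "\<phi> \<in> formulas L (Suc l)"
  shows "ex1 l \<phi> \<in> formulas L l"
proof -
  have "rename (\<lambda>v. if v = 0 then l else if v \<le> l then v - 1 else v) \<phi> \<in> formulas L (Suc l)"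
    by (rule rename_formulas[OF assms inj_ex1]) auto
  then show ?thesis by (auto simp: formulas_def ex1_def less_Suc_eq)
qed

lemma sat_ex1:
  assumes "\<phi> \<in> formulas L (Suc (length as))"
  shows "sat N ((!) as) (ex1 (length as) \<phi>) \<longleftrightarrow> (\<exists>a\<in>univ N. sat N ((!) (a # as)) \<phi>)"
proof -
  have "sat N (((!) as)(length as := a))
      (rename (\<lambda>v. if v = 0 then length as else if v \<le> length as then v - 1 else v) \<phi>)
    = sat N ((!) (a # as)) \<phi>" for a
    by (rule sat_rename_agree[OF assms inj_ex1]) (auto simp: nth_Cons')
  then show ?thesis by (simp add: ex1_def)
qed

text \<open>Existential quantification over the first \<open>s\<close> of \<open>s + l\<close> variables; the remaining ones are
  renumbered.\<close>

fun exb :: "nat \<Rightarrow> nat \<Rightarrow> ('f, 'r) fm \<Rightarrow> ('f, 'r) fm" where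
  "exb 0 l \<phi> = \<phi>"
| "exb (Suc s) l \<phi> = exb s l (ex1 (s + l) \<phi>)"

lemma exb_formulas: "\<phi> \<in> formulas L (s + l) \<Longrightarrow> exb s l \<phi> \<in> formulas L l"
  by (induction s arbitrary: \<phi>) (auto simp: ex1_formulas)

lemma tuples_0 [simp]: "tuples N 0 = {[]}"
  by (auto simp: tuples_def)

lemma tuples_Suc: "tuples N (Suc s) = {a # c | a c. a \<in> univ N \<and> c \<in> tuples N s}"
  by (auto simp: tuples_def length_Suc_conv)

lemma tuples_length: "c \<in> tuples N s \<Longrightarrow> length c = s"
  by (auto simp: tuples_def)

lemma sat_exb:
  assumes "\<phi> \<in> formulas L (s + length as)"
  shows "sat N ((!) as) (exb s (length as) \<phi>) \<longleftrightarrow> (\<exists>c\<in>tuples N s. sat N ((!) (c @ as)) \<phi>)"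
  using assms
proof (induction s arbitrary: \<phi>)
  case (Suc s)
  have "sat N ((!) as) (exb (Suc s) (length as) \<phi>)
    \<longleftrightarrow> (\<exists>c\<in>tuples N s. sat N ((!) (c @ as)) (ex1 (s + length as) \<phi>))"
    using Suc by (simp add: ex1_formulas)
  also have "\<dots> \<longleftrightarrow> (\<exists>c\<in>tuples N s. \<exists>a\<in>univ N. sat N ((!) (a # c @ as)) \<phi>)"
  proof (rule bex_cong[OF refl])
    fix c assume "c \<in> tuples N s"
    then show "sat N ((!) (c @ as)) (ex1 (s + length as) \<phi>) \<longleftrightarrow> (\<exists>a\<in>univ N. sat N ((!) (a # c @ as)) \<phi>)"
      using sat_ex1[of \<phi> L "c @ as" N] Suc.prems by (simp add: tuples_length)
  qed
  also have "\<dots> \<longleftrightarrow> (\<exists>c\<in>tuples N (Suc s). sat N ((!) (c @ as)) \<phi>)"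
    unfolding tuples_Suc by (safe; force)
  finally show ?case .
qed simp

text \<open>The language has no primitive truth constant. This sentence is closed, hence a formula
  in any number of variables, and propositionally valid.\<close>

definition truth :: "('f, 'r) fm" where
  "truth = (let \<phi> = Exists 0 (Eq (Var 0) (Var 0)) in Neg (Conj \<phi> (Neg \<phi>)))"

lemma sat_truth [simp]: "sat N e truth"
  by (simp add: truth_def Let_def)

lemma truth_formulas [simp]: "truth \<in> formulas L l"
  by (simp add: truth_def Let_def formulas_def)

fun ands :: "('f, 'r) fm list \<Rightarrow> ('f, 'r) fm" where
  "ands [] = truth"
| "ands (\<phi> # \<phi>s) = Conj \<phi> (ands \<phi>s)"

definition bigand :: "('f, 'r) fm set \<Rightarrow> ('f, 'r) fm" where
  "bigand S = ands (SOME \<phi>s. set \<phi>s = S)"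

lemma bigand_formulas:
  assumes "finite S" "S \<subseteq> formulas L l"
  shows "bigand S \<in> formulas L l"
proof -
  have *: "set \<phi>s \<subseteq> formulas L l \<Longrightarrow> ands \<phi>s \<in> formulas L l" for \<phi>s
    by (induction \<phi>s) auto
  show ?thesis unfolding bigand_def
    by (rule *) (metis (mono_tags, lifting) assms finite_list someI_ex)
qed

lemma sat_bigand:
  assumes "finite S"
  shows "sat N e (bigand S) \<longleftrightarrow> (\<forall>\<phi>\<in>S. sat N e \<phi>)"
proof -
  have *: "sat N e (ands \<phi>s) \<longleftrightarrow> (\<forall>\<phi>\<in>set \<phi>s. sat N e \<phi>)" for \<phi>s
    by (induction \<phi>s) auto
  have "set (SOME \<phi>s. set \<phi>s = S) = S"
    by (metis (mono_tags, lifting) assms finite_list someI_ex)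
  then show ?thesis unfolding bigand_def * by simp
qed

section \<open>Countability of the set of formulas\<close>

instance tm :: (countable) countable
  by countable_datatype

instance fm :: (countable, countable) countable
  by countable_datatype

lemma wf_tm_symbols: "wf_tm L t \<Longrightarrow> set_tm t \<subseteq> funs L"
  by (induction t) auto

lemma wf_fm_symbols: "wf_fm L \<phi> \<Longrightarrow> set1_fm \<phi> \<subseteq> funs L \<and> set2_fm \<phi> \<subseteq> rels L"
  by (induction \<phi>) (auto dest: subsetD[OF wf_tm_symbols])

text \<open>The symbols of \<open>L\<close> are countable, the types that they are drawn from may
  not be. Coding the symbols by natural numbers maps formulas into a countable datatype, injectively
  because well-formed formulas contain symbols of \<open>L\<close> only.\<close>

lemma countable_formulas:
  assumes "countable_language L"
  shows "countable (formulas L l)"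
proof -
  obtain f :: "'a \<Rightarrow> nat" and g :: "'b \<Rightarrow> nat" where fg: "inj_on f (funs L)" "inj_on g (rels L)"
    using assms by (auto simp: countable_language_def countable_def)
  have "inj_on (map_fm f g) (formulas L l)"
  proof (rule inj_onI)
    fix \<phi> \<psi> assume *: "\<phi> \<in> formulas L l" "\<psi> \<in> formulas L l" "map_fm f g \<phi> = map_fm f g \<psi>"
    have "set1_fm \<phi> \<subseteq> funs L" "set1_fm \<psi> \<subseteq> funs L" "set2_fm \<phi> \<subseteq> rels L" "set2_fm \<psi> \<subseteq> rels L"
      using * wf_fm_symbols by (auto simp: formulas_def)
    with * fg show "\<phi> = \<psi>"
      by (intro fm.inj_map_strong[of \<phi> \<psi> f f g g]) (auto dest: inj_onD)
  qed
  then show ?thesis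
    by (metis countableI_type countable_image_inj_on)
qed

section \<open>Solution sets over concatenated parameter tuples\<close>

lemma tuples_append:
  "c \<in> tuples N s \<Longrightarrow> set as \<subseteq> univ N \<Longrightarrow> set (c @ as) \<subseteq> univ N"
  by (auto simp: tuples_def)

lemma tuplesI: "set c \<subseteq> univ N \<Longrightarrow> length c = s \<Longrightarrow> c \<in> tuples N s"
  by (auto simp: tuples_def)

lemma mem_solset: "xs \<in> solset N n (\<phi>, as) \<longleftrightarrow> xs \<in> tuples N n \<and> sat N ((!) (xs @ as)) \<phi>"
  by (simp add: solset_def)

lemma solset_lift:
  assumes "\<phi> \<in> formulas L (n + length as)"
  shows "solset N n (lift n (length cs) \<phi>, cs @ as) = solset N n (\<phi>, as)"
proof -
  have "sat N ((!) (xs @ cs @ as)) (lift n (length cs) \<phi>) = sat N ((!) (xs @ as)) \<phi>"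
    if "xs \<in> tuples N n" for xs
    using sat_lift[of \<phi> L xs as N cs] assms tuples_length[OF that] by simp
  then show ?thesis by (auto simp: solset_def)
qed

lemma solset_append:
  assumes "\<phi> \<in> formulas L (n + length as)"
  shows "solset N n (\<phi>, as @ bs) = solset N n (\<phi>, as)"
proof -
  have "sat N ((!) (xs @ as @ bs)) \<phi> = sat N ((!) (xs @ as)) \<phi>" if "xs \<in> tuples N n" for xs
    using sat_append[of \<phi> L "n + length as" "xs @ as" N bs] assms tuples_length[OF that] by simp
  then show ?thesis by (auto simp: solset_def)
qed

lemma solset_Conj: "solset N n (Conj \<phi> \<psi>, as) = solset N n (\<phi>, as) \<inter> solset N n (\<psi>, as)"
  by (auto simp: solset_def)

text \<open>One parameter tuple has to serve both conjuncts: \<open>\<phi>\<close> skips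
  \<open>c\<close> through the gap, while \<open>\<psi>\<close> reads the prefix \<open>c\<close>
  and never reaches \<open>as\<close>.\<close>

lemma solset_meet:
  assumes "\<phi> \<in> formulas L (n + length as)" "\<psi> \<in> formulas L (n + length c)"
  shows "solset N n (Conj (lift n (length c) \<phi>) \<psi>, c @ as)
    = solset N n (\<phi>, as) \<inter> solset N n (\<psi>, c)"
  by (simp add: solset_Conj solset_lift[OF assms(1)] solset_append[OF assms(2)])

lemma meet_formulas:
  assumes "\<phi> \<in> formulas L (n + length as)" "\<psi> \<in> formulas L (n + length c)"
  shows "Conj (lift n (length c) \<phi>) \<psi> \<in> formulas L (n + length (c @ as))"
  using lift_formulas[OF assms(1) refl, of "length c"] formulas_mono'[OF assms(2)]
  by (simp add: add.assoc)

section \<open>Inconsistent families\<close>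

definition kinconsistent :: "('f, 'r, 'a) fostruct \<Rightarrow> nat \<Rightarrow> ('f, 'r) fm \<Rightarrow> nat \<Rightarrow> nat
    \<Rightarrow> (nat \<Rightarrow> 'a list) \<Rightarrow> bool" where
  "kinconsistent N n \<psi> k m cs \<longleftrightarrow>
     (\<forall>I\<subseteq>{..<m}. card I = k \<longrightarrow> \<not> (\<exists>xs\<in>tuples N n. \<forall>i\<in>I. sat N ((!) (xs @ cs i)) \<psi>))"

text \<open>The finite trace of dividing: for fixed \<open>\<chi>\<close>, \<open>\<psi>\<close>,
  \<open>k\<close> and \<open>m\<close> this is one first-order condition on \<open>as\<close>,
  unlike the sequences in \<open>divides\<close>.\<close>

definition has_family :: "('f, 'r, 'a) fostruct \<Rightarrow> 'a list \<Rightarrow> nat \<Rightarrow> nat \<Rightarrow> ('f, 'r) fm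
    \<Rightarrow> ('f, 'r) fm \<Rightarrow> nat \<Rightarrow> nat \<Rightarrow> bool" where
  "has_family N as n s \<chi> \<psi> k m \<longleftrightarrow>
     (\<exists>cs. (\<forall>i<m. cs i \<in> tuples N s \<and> sat N ((!) (cs i @ as)) \<chi>) \<and> kinconsistent N n \<psi> k m cs)"

text \<open>An \<open>m\<close>-tuple of \<open>s\<close>-tuples is coded by a single tuple of length \<open>m * s\<close>.\<close>

definition block :: "nat \<Rightarrow> nat \<Rightarrow> 'a list \<Rightarrow> 'a list" where
  "block s i C = take s (drop (i * s) C)"

definition block_index :: "nat \<Rightarrow> nat \<Rightarrow> nat \<Rightarrow> nat \<Rightarrow> nat" where
  "block_index s m i v = (if v < s then i * s + v else v - s + m * s)"

lemma block_bound: "i < m \<Longrightarrow> i * s + s \<le> m * (s :: nat)"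
  using mult_le_mono1[of "Suc i" m s] by simp

lemma inj_block_index: "i < m \<Longrightarrow> inj (block_index s m i)"
  using block_bound[of i m s] by (auto simp: inj_def block_index_def split: if_splits)

lemma block_tuples: "C \<in> tuples N (m * s) \<Longrightarrow> i < m \<Longrightarrow> block s i C \<in> tuples N s"
  using block_bound[of i m s]
  by (auto simp: tuples_def block_def dest!: in_set_takeD in_set_dropD)

lemma exists_blocks:
  assumes "\<And>i. i < m \<Longrightarrow> cs i \<in> tuples N s"
  shows "\<exists>C\<in>tuples N (m * s). \<forall>i<m. block s i C = cs i"
proof -
  let ?C = "map (\<lambda>v. cs (v div s) ! (v mod s)) [0..<m * s]"
  have "?C \<in> tuples N (m * s)"
  proof -
    have "cs (v div s) ! (v mod s) \<in> univ N" if "v < m * s" for v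
    proof -
      have "v div s < m" "v mod s < s"
        using that by (cases "s = 0"; simp add: less_mult_imp_div_less)+
      then show ?thesis using assms[of "v div s"] by (auto simp: tuples_def subset_iff)
    qed
    then show ?thesis by (auto simp: tuples_def)
  qed
  moreover have "block s i ?C = cs i" if "i < m" for i
  proof (rule nth_equalityI)
    note b = block_bound[OF that, of s] and l = tuples_length[OF assms[OF that]]
    have b': "i * s \<le> m * s" using b by (rule add_leD1)
    show "length (block s i ?C) = length (cs i)"
      using b l by (simp add: block_def)
    fix j assume "j < length (block s i ?C)"
    then have "j < s" by (simp add: block_def)
    then show "block s i ?C ! j = cs i ! j"
      using b b' by (simp add: block_def nth_drop)
  qed
  ultimately show ?thesis by blast
qed

lemma block_nth: "length C = m * s \<Longrightarrow> i < m \<Longrightarrow> v < s \<Longrightarrow> block s i C ! v = C ! (i * s + v)"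
  using block_bound[of i m s] by (simp add: block_def)

text \<open>The outer quantifier guesses all \<open>m\<close> tuples as one block of
  \<open>m * s\<close> variables. In \<open>\<chi>\<close>, \<open>block_index\<close> selects block
  \<open>i\<close> and finds the parameters behind all the blocks; in \<open>\<psi>\<close>, a gap
  of \<open>i * s\<close> skips the earlier blocks and nothing behind block \<open>i\<close> is
  read.\<close>

definition witness_formula :: "nat \<Rightarrow> nat \<Rightarrow> nat \<Rightarrow> ('f, 'r) fm \<Rightarrow> ('f, 'r) fm \<Rightarrow> nat \<Rightarrow> nat
    \<Rightarrow> ('f, 'r) fm" where
  "witness_formula n s l \<chi> \<psi> k m = exb (m * s) l
     (Conj (bigand ((\<lambda>i. rename (block_index s m i) \<chi>) ` {..<m}))
       (bigand ((\<lambda>I. Neg (exb n (m * s + l) (bigand ((\<lambda>i. lift n (i * s) \<psi>) ` I))))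
         ` {I. I \<subseteq> {..<m} \<and> card I = k})))"

lemma witness_formula:
  assumes \<chi>: "\<chi> \<in> formulas L (s + length as)" and \<psi>: "\<psi> \<in> formulas L (n + s)"
  shows "witness_formula n s (length as) \<chi> \<psi> k m \<in> formulas L (length as)"
    and "sat N ((!) as) (witness_formula n s (length as) \<chi> \<psi> k m) \<longleftrightarrow> has_family N as n s \<chi> \<psi> k m"
proof -
  define l where "l = length as"
  let ?A = "(\<lambda>i. rename (block_index s m i) \<chi>) ` {..<m}"
  let ?B = "\<lambda>I. (\<lambda>i. lift n (i * s) \<psi>) ` I"
  let ?C = "(\<lambda>I. Neg (exb n (m * s + l) (bigand (?B I)))) ` {I. I \<subseteq> {..<m} \<and> card I = k}"
  have fin: "finite {I. I \<subseteq> {..<m} \<and> card I = k}"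
    by (rule finite_subset[of _ "Pow {..<m}"]) auto
  have finI: "finite I" if "I \<subseteq> {..<m}" for I
    using that finite_subset by blast
  have A: "?A \<subseteq> formulas L (m * s + l)"
  proof
    fix \<theta> assume "\<theta> \<in> ?A"
    then obtain i where i: "i < m" "\<theta> = rename (block_index s m i) \<chi>" by auto
    show "\<theta> \<in> formulas L (m * s + l)"
      unfolding i using block_bound[OF i(1), of s] \<chi>
      by (intro rename_formulas[OF \<chi> inj_block_index[OF i(1)]]) (auto simp: block_index_def l_def)
  qed
  have B: "bigand (?B I) \<in> formulas L (n + (m * s + l))" if "I \<subseteq> {..<m}" for I
  proof (rule bigand_formulas)
    show "?B I \<subseteq> formulas L (n + (m * s + l))"
    proof
      fix \<theta> assume "\<theta> \<in> ?B I"
      then obtain i where i: "i \<in> I" "\<theta> = lift n (i * s) \<psi>" by auto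
      then have "i < m" using that by auto
      then show "\<theta> \<in> formulas L (n + (m * s + l))"
        using i block_bound[of i m s] by (auto intro: formulas_mono'[OF lift_formulas[OF \<psi> refl]])
    qed
  qed (use that finI in auto)
  have C: "?C \<subseteq> formulas L (m * s + l)"
    using B by (auto intro!: exb_formulas)
  have body: "Conj (bigand ?A) (bigand ?C) \<in> formulas L (m * s + l)"
    using A C fin by (auto intro!: bigand_formulas)
  show "witness_formula n s (length as) \<chi> \<psi> k m \<in> formulas L (length as)"
    using exb_formulas[OF body] by (simp add: witness_formula_def l_def)
  have "sat N ((!) as) (witness_formula n s (length as) \<chi> \<psi> k m) \<longleftrightarrow>
      (\<exists>C\<in>tuples N (m * s). sat N ((!) (C @ as)) (Conj (bigand ?A) (bigand ?C)))"
    unfolding witness_formula_def l_def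
    by (rule sat_exb) (use body in \<open>simp add: l_def\<close>)
  also have "\<dots> \<longleftrightarrow> (\<exists>C\<in>tuples N (m * s).
      (\<forall>i<m. sat N ((!) (block s i C @ as)) \<chi>) \<and> kinconsistent N n \<psi> k m (\<lambda>i. block s i C))"
  proof (rule bex_cong[OF refl])
    fix C assume Ct: "C \<in> tuples N (m * s)"
    then have len: "length C = m * s" by (rule tuples_length)
    have blen: "length (block s i C) = s" if "i < m" for i
      using block_tuples[OF Ct that] by (rule tuples_length)
    have "sat N ((!) (C @ as)) (rename (block_index s m i) \<chi>) = sat N ((!) (block s i C @ as)) \<chi>"
      if "i < m" for i
      by (rule sat_rename_agree[OF \<chi> inj_block_index[OF that]])
        (use len blen[OF that] block_bound[OF that, of s] block_nth[OF len that] in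
          \<open>auto simp: block_index_def nth_append\<close>)
    then have 1: "sat N ((!) (C @ as)) (bigand ?A) \<longleftrightarrow> (\<forall>i<m. sat N ((!) (block s i C @ as)) \<chi>)"
      by (subst sat_bigand) auto
    have *: "sat N ((!) (xs @ C @ as)) (lift n (i * s) \<psi>) = sat N ((!) (xs @ block s i C)) \<psi>"
      if "i < m" "xs \<in> tuples N n" for i xs
      unfolding lift_def
    proof (rule sat_rename_agree[OF \<psi> inj_lift])
      fix v assume v: "v < n + s"
      have xs: "length xs = n" using that(2) by (rule tuples_length)
      show "(xs @ C @ as) ! (if v < n then v else v + i * s) = (xs @ block s i C) ! v"
      proof (cases "v < n")
        case False
        then obtain j where j: "v = n + j" "j < s" using v by (metis le_Suc_ex nat_add_left_cancel_less not_less)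
        then have "i * s + j < m * s" using block_bound[OF that(1), of s] by linarith
        then show ?thesis
          using j xs len block_nth[OF len that(1) j(2)]
          by (simp add: nth_append add.commute add.left_commute)
      qed (use xs in \<open>simp add: nth_append\<close>)
    qed
    have "sat N ((!) (C @ as)) (exb n (m * s + l) (bigand (?B I)))
      \<longleftrightarrow> (\<exists>xs\<in>tuples N n. \<forall>i\<in>I. sat N ((!) (xs @ block s i C)) \<psi>)" if "I \<subseteq> {..<m}" for I
    proof -
      have "sat N ((!) (C @ as)) (exb n (m * s + l) (bigand (?B I)))
        \<longleftrightarrow> (\<exists>xs\<in>tuples N n. sat N ((!) (xs @ C @ as)) (bigand (?B I)))"
        using sat_exb[of "bigand (?B I)" L n "C @ as" N] B[OF that] len by (simp add: l_def)
      also have "\<dots> \<longleftrightarrow> (\<exists>xs\<in>tuples N n. \<forall>i\<in>I. sat N ((!) (xs @ block s i C)) \<psi>)"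
        using that * finI[OF that] by (intro bex_cong refl, subst sat_bigand) auto
      finally show ?thesis .
    qed
    then have 2: "sat N ((!) (C @ as)) (bigand ?C) \<longleftrightarrow> kinconsistent N n \<psi> k m (\<lambda>i. block s i C)"
      using fin by (subst sat_bigand) (auto simp: kinconsistent_def)
    show "sat N ((!) (C @ as)) (Conj (bigand ?A) (bigand ?C)) \<longleftrightarrow>
      (\<forall>i<m. sat N ((!) (block s i C @ as)) \<chi>) \<and> kinconsistent N n \<psi> k m (\<lambda>i. block s i C)"
      using 1 2 by simp
  qed
  also have "\<dots> \<longleftrightarrow> has_family N as n s \<chi> \<psi> k m"
  proof
    assume "has_family N as n s \<chi> \<psi> k m"
    then obtain cs where cs: "\<And>i. i < m \<Longrightarrow> cs i \<in> tuples N s"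
      "\<And>i. i < m \<Longrightarrow> sat N ((!) (cs i @ as)) \<chi>" "kinconsistent N n \<psi> k m cs"
      by (auto simp: has_family_def)
    obtain C where C: "C \<in> tuples N (m * s)" "\<And>i. i < m \<Longrightarrow> block s i C = cs i"
      using exists_blocks[of m cs N s] cs(1) by blast
    have "kinconsistent N n \<psi> k m (\<lambda>i. block s i C)"
      using cs(3) C(2) unfolding kinconsistent_def
      by (metis (no_types, lifting) lessThan_iff subset_iff)
    with C cs(2) show "\<exists>C\<in>tuples N (m * s).
      (\<forall>i<m. sat N ((!) (block s i C @ as)) \<chi>) \<and> kinconsistent N n \<psi> k m (\<lambda>i. block s i C)"
      by (intro bexI[of _ C]) simp_all
  next
    assume "\<exists>C\<in>tuples N (m * s).
      (\<forall>i<m. sat N ((!) (block s i C @ as)) \<chi>) \<and> kinconsistent N n \<psi> k m (\<lambda>i. block s i C)"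
    then show "has_family N as n s \<chi> \<psi> k m"
      unfolding has_family_def using block_tuples[of _ N m s]
      by (elim bexE) (rule_tac x = "\<lambda>i. block s i C" in exI, blast)
  qed
  finally show "sat N ((!) as) (witness_formula n s (length as) \<chi> \<psi> k m)
    \<longleftrightarrow> has_family N as n s \<chi> \<psi> k m" .
qed

text \<open>Inconsistency passes to subfamilies, and \<open>\<chi>\<close> and \<open>as\<close> are
  tested on \<open>J\<close> only. Thus a formula without a family of size \<open>m'\<close> holds
  at fewer than \<open>m'\<close> members of any k-inconsistent family; this is the form used in
  \<open>fdiv_extend\<close>.\<close>

lemma has_family_subfamily:
  assumes cs: "\<And>i. i \<in> J \<Longrightarrow> cs i \<in> tuples N s \<and> sat N ((!) (cs i @ as)) \<chi>"
    and "kinconsistent N n \<psi> k m cs" "J \<subseteq> {..<m}" "m' \<le> card J"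
  shows "has_family N as n s \<chi> \<psi> k m'"
proof -
  have "finite J" using assms(3) finite_subset by blast
  then obtain g where g: "bij_betw g {..<card J} J"
    using ex_bij_betw_nat_finite[of J] by (auto simp: atLeast0LessThan)
  have inj: "inj_on g {..<m'}" and img: "g ` {..<m'} \<subseteq> J"
    using g assms(4) by (auto simp: bij_betw_def intro: inj_on_subset)
  have "kinconsistent N n \<psi> k m' (cs \<circ> g)"
    unfolding kinconsistent_def
  proof (intro allI impI notI)
    fix I assume I: "I \<subseteq> {..<m'}" "card I = k"
      "\<exists>xs\<in>tuples N n. \<forall>i\<in>I. sat N ((!) (xs @ (cs \<circ> g) i)) \<psi>"
    have "g ` I \<subseteq> {..<m}" using I(1) img assms(3) by blast
    moreover have "card (g ` I) = k" using I inj by (metis card_image inj_on_subset)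
    ultimately have "\<not> (\<exists>xs\<in>tuples N n. \<forall>i\<in>g ` I. sat N ((!) (xs @ cs i)) \<psi>)"
      using assms(2) unfolding kinconsistent_def by blast
    with I(3) show False by auto
  qed
  moreover have "(cs \<circ> g) i \<in> tuples N s \<and> sat N ((!) ((cs \<circ> g) i @ as)) \<chi>" if "i < m'" for i
    using cs img that by auto
  ultimately show ?thesis unfolding has_family_def by blast
qed

lemma has_family_mono:
  assumes "has_family N as n s \<chi> \<psi> k m"
    and "\<And>c. c \<in> tuples N s \<Longrightarrow> sat N ((!) (c @ as)) \<chi> \<Longrightarrow> sat N ((!) (c @ as')) \<chi>'"
  shows "has_family N as' n s \<chi>' \<psi> k m"
  using assms unfolding has_family_def by blast

section \<open>Equality of types\<close>

text \<open>Two structures are allowed so that one notion covers equality of types inside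
  \<open>N\<close>, the correspondence between \<open>N\<close> and \<open>M\<close>, and, for empty
  tuples, elementary equivalence.\<close>

definition teq :: "('f, 'r) language \<Rightarrow> ('f, 'r, 'a) fostruct \<Rightarrow> 'a list
    \<Rightarrow> ('f, 'r, 'b) fostruct \<Rightarrow> 'b list \<Rightarrow> bool" where
  "teq L N as M bs \<longleftrightarrow> length as = length bs \<and>
     (\<forall>\<chi>\<in>formulas L (length as). sat N ((!) as) \<chi> = sat M ((!) bs) \<chi>)"

lemma teq_sym: "teq L N as M bs \<Longrightarrow> teq L M bs N as"
  by (auto simp: teq_def)

lemma teq_length: "teq L N as M bs \<Longrightarrow> length bs = length as"
  by (auto simp: teq_def)

lemma teq_sat: "teq L N as M bs \<Longrightarrow> \<chi> \<in> formulas L (length as) \<Longrightarrow> sat N ((!) as) \<chi> = sat M ((!) bs) \<chi>"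
  by (auto simp: teq_def)

lemma teq_drop_middle:
  assumes "teq L N (xs @ cs @ as) M (ys @ ds @ bs)" "length xs = length ys" "length cs = length ds"
  shows "teq L N (xs @ as) M (ys @ bs)"
  unfolding teq_def
proof (intro conjI ballI)
  show "length (xs @ as) = length (ys @ bs)" using assms by (auto simp: teq_def)
  fix \<chi> assume \<chi>: "\<chi> \<in> formulas L (length (xs @ as))"
  then have "lift (length xs) (length cs) \<chi> \<in> formulas L (length (xs @ cs @ as))"
    by (auto intro: lift_formulas)
  then have "sat N ((!) (xs @ cs @ as)) (lift (length xs) (length cs) \<chi>)
    = sat M ((!) (ys @ ds @ bs)) (lift (length ys) (length ds) \<chi>)"
    using assms by (auto simp: teq_def)
  then show "sat N ((!) (xs @ as)) \<chi> = sat M ((!) (ys @ bs)) \<chi>"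
    using sat_lift[of \<chi> L xs as N cs] sat_lift[of \<chi> L ys bs M ds] \<chi> assms by (auto simp: teq_def)
qed

lemma teq_suffix:
  "teq L N (cs @ as) M (ds @ bs) \<Longrightarrow> length cs = length ds \<Longrightarrow> teq L N as M bs"
  using teq_drop_middle[of L N "[]" cs as M "[]" ds bs] by simp

lemma teq_prefix:
  "teq L N (as @ cs) M (bs @ ds) \<Longrightarrow> length as = length bs \<Longrightarrow> teq L N as M bs"
  using teq_drop_middle[of L N as cs "[]" M bs ds "[]"] by (auto simp: teq_def)

text \<open>This is the purpose of \<open>witness_formula\<close>: families depend only on the type
  of the parameters, so dividing can be carried from one structure to another.\<close>

lemma teq_has_family:
  assumes "teq L N as M bs" "\<chi> \<in> formulas L (s + length as)" "\<psi> \<in> formulas L (n + s)"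
  shows "has_family N as n s \<chi> \<psi> k m = has_family M bs n s \<chi> \<psi> k m"
  using witness_formula(2)[where \<chi> = \<chi> and L = L and s = s and as = as and \<psi> = \<psi> and n = n and N = N]
    witness_formula(2)[where \<chi> = \<chi> and L = L and s = s and as = bs and \<psi> = \<psi> and n = n and N = M]
    witness_formula(1)[where \<chi> = \<chi> and L = L and s = s and as = as and \<psi> = \<psi> and n = n] assms
  by (simp add: teq_def)

lemma teq_solset_empty:
  assumes "teq L N as M bs" "\<phi> \<in> formulas L (n + length as)"
  shows "solset N n (\<phi>, as) = {} \<longleftrightarrow> solset M n (\<phi>, bs) = {}"
  using sat_exb[of \<phi> L n as N] sat_exb[of \<phi> L n bs M] teq_sat[OF assms(1) exb_formulas[OF assms(2)]]
    assms by (auto simp: solset_def teq_def)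

section \<open>Saturation over finite parameter tuples\<close>

definition omega_saturated :: "('f, 'r) language \<Rightarrow> ('f, 'r, 'a) fostruct \<Rightarrow> bool" where
  "omega_saturated L N \<longleftrightarrow>
     (\<forall>s as \<Sigma>. set as \<subseteq> univ N \<and> \<Sigma> \<subseteq> formulas L (s + length as) \<and>
        (\<forall>\<Sigma>\<^sub>0\<subseteq>\<Sigma>. finite \<Sigma>\<^sub>0 \<longrightarrow> (\<exists>c\<in>tuples N s. \<forall>\<chi>\<in>\<Sigma>\<^sub>0. sat N ((!) (c @ as)) \<chi>)) \<longrightarrow>
        (\<exists>c\<in>tuples N s. \<forall>\<chi>\<in>\<Sigma>. sat N ((!) (c @ as)) \<chi>))"

lemma omega_saturated_realize:
  assumes "omega_saturated L N" "set as \<subseteq> univ N" "\<Sigma> \<subseteq> formulas L (s + length as)"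
    and "\<And>\<Sigma>\<^sub>0. \<Sigma>\<^sub>0 \<subseteq> \<Sigma> \<Longrightarrow> finite \<Sigma>\<^sub>0 \<Longrightarrow> \<exists>c\<in>tuples N s. \<forall>\<chi>\<in>\<Sigma>\<^sub>0. sat N ((!) (c @ as)) \<chi>"
  shows "\<exists>c\<in>tuples N s. \<forall>\<chi>\<in>\<Sigma>. sat N ((!) (c @ as)) \<chi>"
  using assms unfolding omega_saturated_def by blast

lemma saturated_for_omega:
  assumes "saturated_for L N B"
  shows "omega_saturated L N"
  unfolding omega_saturated_def
proof (intro allI impI)
  fix s as \<Sigma>
  assume *: "set as \<subseteq> univ N \<and> \<Sigma> \<subseteq> formulas L (s + length as) \<and>
    (\<forall>\<Sigma>\<^sub>0\<subseteq>\<Sigma>. finite \<Sigma>\<^sub>0 \<longrightarrow> (\<exists>c\<in>tuples N s. \<forall>\<chi>\<in>\<Sigma>\<^sub>0. sat N ((!) (c @ as)) \<chi>))"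
  let ?p = "(\<lambda>\<chi>. (\<chi>, as)) ` \<Sigma>"
  \<comment> \<open>The equations between a variable and itself are well formed in every language,
    so a finite parameter set always obeys the cardinality bound in \<open>saturated_for\<close>,
    even for empty \<open>B\<close>.\<close>
  have "infinite {\<phi> :: ('a, 'b) fm. wf_fm L \<phi>}"
  proof (rule infinite_super)
    show "range (\<lambda>i. Eq (Var i) (Var i)) \<subseteq> {\<phi> :: ('a, 'b) fm. wf_fm L \<phi>}" by auto
    show "infinite (range (\<lambda>i. Eq (Var i) (Var i) :: ('a, 'b) fm))"
      by (rule range_inj_infinite) (auto simp: inj_def)
  qed
  then have "set as \<lesssim> B <+> {\<phi> :: ('a, 'b) fm. wf_fm L \<phi>}"
    by (intro finite_lepoll_infinite) (auto dest: finite_PlusD)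
  moreover have "partial_type L N (set as) s ?p"
    unfolding partial_type_def
  proof (intro conjI allI impI)
    show "?p \<subseteq> pformulas L (set as) s" using * by (auto simp: pformulas_iff)
    fix q assume q: "finite q \<and> q \<subseteq> ?p"
    then obtain \<Sigma>\<^sub>0 where "\<Sigma>\<^sub>0 \<subseteq> \<Sigma>" "finite \<Sigma>\<^sub>0" "q = (\<lambda>\<chi>. (\<chi>, as)) ` \<Sigma>\<^sub>0"
      by (metis finite_subset_image)
    with * show "realizations N s q \<noteq> {}"
      by (auto simp: realizations_def mem_solset)
  qed
  ultimately have "realizations N s ?p \<noteq> {}"
    using assms[unfolded saturated_for_def, rule_format, of "set as" s ?p] * by simp
  then show "\<exists>c\<in>tuples N s. \<forall>\<chi>\<in>\<Sigma>. sat N ((!) (c @ as)) \<chi>"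
    by (auto simp: realizations_def mem_solset)
qed

lemma teq_of_subtype:
  assumes "length as = length bs"
    and "\<And>\<chi>. \<chi> \<in> formulas L (length as) \<Longrightarrow> sat N ((!) as) \<chi> \<Longrightarrow> sat M ((!) bs) \<chi>"
  shows "teq L N as M bs"
  unfolding teq_def
proof (intro conjI ballI)
  fix \<chi> assume "\<chi> \<in> formulas L (length as)"
  then show "sat N ((!) as) \<chi> = sat M ((!) bs) \<chi>"
    using assms(2)[of \<chi>] assms(2)[of "Neg \<chi>"] by auto
qed fact

lemma teq_finite_extension:
  assumes "teq L M as N bs" "c \<in> tuples M s"
    and "finite \<Sigma>" "\<Sigma> \<subseteq> formulas L (s + length as)" "\<And>\<chi>. \<chi> \<in> \<Sigma> \<Longrightarrow> sat M ((!) (c @ as)) \<chi>"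
  shows "\<exists>c'\<in>tuples N s. \<forall>\<chi>\<in>\<Sigma>. sat N ((!) (c' @ bs)) \<chi>"
proof -
  have \<beta>: "bigand \<Sigma> \<in> formulas L (s + length as)" using assms by (intro bigand_formulas)
  have "sat M ((!) as) (exb s (length as) (bigand \<Sigma>))"
    unfolding sat_exb[OF \<beta>, of M] sat_bigand[OF assms(3)] using assms(2,5) by blast
  then have "sat N ((!) bs) (exb s (length as) (bigand \<Sigma>))"
    using teq_sat[OF assms(1) exb_formulas[OF \<beta>]] by simp
  then show ?thesis
    using sat_exb[of "bigand \<Sigma>" L s bs N] \<beta> teq_length[OF assms(1)]
    by (simp add: sat_bigand[OF assms(3)])
qed

text \<open>The back-and-forth step: consistency of a finite part of the type of \<open>c\<close> is
  a formula about \<open>as\<close>, hence true of \<open>bs\<close>, and saturation realizes the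
  whole type.\<close>

lemma omega_saturated_extend:
  assumes "omega_saturated L N" "teq L M as N bs" "c \<in> tuples M s" "set bs \<subseteq> univ N"
  obtains c' where "c' \<in> tuples N s" "teq L M (c @ as) N (c' @ bs)"
proof -
  let ?\<Sigma> = "{\<chi> \<in> formulas L (s + length bs). sat M ((!) (c @ as)) \<chi>}"
  have "\<exists>c'\<in>tuples N s. \<forall>\<chi>\<in>?\<Sigma>. sat N ((!) (c' @ bs)) \<chi>"
    using assms(1,4)
  proof (rule omega_saturated_realize)
    fix \<Sigma>\<^sub>0 assume "\<Sigma>\<^sub>0 \<subseteq> ?\<Sigma>" "finite \<Sigma>\<^sub>0"
    then show "\<exists>c\<in>tuples N s. \<forall>\<chi>\<in>\<Sigma>\<^sub>0. sat N ((!) (c @ bs)) \<chi>"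
      using teq_length[OF assms(2)] by (intro teq_finite_extension[OF assms(2,3)]) auto
  qed auto
  then obtain c' where c': "c' \<in> tuples N s" "\<forall>\<chi>\<in>?\<Sigma>. sat N ((!) (c' @ bs)) \<chi>" by blast
  have "teq L M (c @ as) N (c' @ bs)"
    using c' tuples_length[OF c'(1)] tuples_length[OF assms(3)] teq_length[OF assms(2)]
    by (intro teq_of_subtype) auto
  with c'(1) show thesis by (rule that)
qed

section \<open>Dividing\<close>

text \<open>A finitary form of dividing over \<open>as\<close>; it agrees with the usual notion in
  \<open>\<omega>\<close>-saturated models and needs no infinite sequences.\<close>

definition fdiv :: "('f, 'r) language \<Rightarrow> ('f, 'r, 'a) fostruct \<Rightarrow> 'a list \<Rightarrow> nat \<Rightarrow> ('f, 'r) fm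
    \<Rightarrow> 'a list \<Rightarrow> nat \<Rightarrow> bool" where
  "fdiv L N as n \<psi> c k \<longleftrightarrow>
     (\<forall>\<chi>\<in>formulas L (length c + length as). sat N ((!) (c @ as)) \<chi> \<longrightarrow>
        (\<forall>m. has_family N as n (length c) \<chi> \<psi> k m))"

text \<open>Every term of the witnessing sequence has the type of \<open>c\<close>, hence satisfies
  \<open>\<chi>\<close>, so the sequence itself supplies families of every size
  \<open>m\<close>.\<close>

lemma divides_imp_fdiv:
  assumes "divides L N (set as) n (\<psi>, c)"
  shows "\<exists>k>0. fdiv L N as n \<psi> c k"
proof -
  obtain k cs where k: "k > 0" and cs: "\<And>i :: nat. cs i \<in> tuples N (length c)"
    and tp: "\<And>i. tp L N (set as) (cs i) = tp L N (set as) c"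
    and inc: "\<And>I. finite I \<Longrightarrow> card I = k \<Longrightarrow> realizations N n ((\<lambda>i. (\<psi>, cs i)) ` I) = {}"
    using assms unfolding divides_def by blast
  have "has_family N as n (length c) \<chi> \<psi> k m"
    if \<chi>: "\<chi> \<in> formulas L (length c + length as)" "sat N ((!) (c @ as)) \<chi>" for \<chi> m
  proof -
    have len: "length (cs i) = length c" for i using cs by (rule tuples_length)
    have "(\<chi>, as) \<in> tp L N (set as) c" if "c \<in> tuples N (length c)"
      using \<chi> that by (simp add: tp_def pformulas_iff mem_solset)
    \<comment> \<open>\<open>divides\<close> does not say that \<open>c\<close> lies in
      \<open>N\<close>. But a tuple outside \<open>N\<close> has empty \<open>tp\<close>, whereas
      the type of \<open>cs 0\<close> contains \<open>truth\<close>.\<close>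
    moreover have "c \<in> tuples N (length c)"
    proof -
      have "(truth, []) \<in> tp L N (set as) (cs 0)"
        using cs[of 0] len[of 0] by (auto simp: tp_def pformulas_iff mem_solset tuples_def)
      then show ?thesis unfolding tp by (simp add: tp_def mem_solset)
    qed
    ultimately have "(\<chi>, as) \<in> tp L N (set as) (cs i)" for i using tp by simp
    then have "sat N ((!) (cs i @ as)) \<chi>" for i by (simp add: tp_def mem_solset)
    moreover have "kinconsistent N n \<psi> k m cs"
      unfolding kinconsistent_def
    proof (intro allI impI notI)
      fix I assume I: "I \<subseteq> {..<m}" "card I = k"
        "\<exists>xs\<in>tuples N n. \<forall>i\<in>I. sat N ((!) (xs @ cs i)) \<psi>"
      have "finite I" using I(1) finite_subset by blast
      then have "realizations N n ((\<lambda>i. (\<psi>, cs i)) ` I) = {}" using inc I(2) by blast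
      with I(3) show False by (auto simp: realizations_def mem_solset)
    qed
    ultimately show ?thesis unfolding has_family_def using cs by blast
  qed
  with k show ?thesis unfolding fdiv_def by blast
qed

text \<open>Fewer parameters leave fewer formulas in the type of \<open>c\<close>, so dividing over
  a longer tuple is the stronger condition. Together with \<open>fdiv_suffix\<close> this serves the
  two halves of a concatenated base.\<close>

lemma fdiv_prefix:
  assumes "fdiv L N (as @ bs) n \<psi> c k"
  shows "fdiv L N as n \<psi> c k"
  unfolding fdiv_def
proof (intro ballI impI allI)
  fix \<chi> m assume \<chi>: "\<chi> \<in> formulas L (length c + length as)" "sat N ((!) (c @ as)) \<chi>"
  have *: "sat N ((!) (c' @ as @ bs)) \<chi> = sat N ((!) (c' @ as)) \<chi>" if "length c' = length c" for c'
    using sat_append[OF \<chi>(1), of "c' @ as" N bs] that by simp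
  have "has_family N (as @ bs) n (length c) \<chi> \<psi> k m"
    using assms \<chi> *[of c] formulas_mono'[OF \<chi>(1), of "length c + length (as @ bs)"]
    by (simp add: fdiv_def)
  then show "has_family N as n (length c) \<chi> \<psi> k m"
    by (rule has_family_mono) (use * tuples_length in blast)
qed

lemma fdiv_suffix:
  assumes "fdiv L N (bs @ as) n \<psi> c k"
  shows "fdiv L N as n \<psi> c k"
  unfolding fdiv_def
proof (intro ballI impI allI)
  fix \<chi> m assume \<chi>: "\<chi> \<in> formulas L (length c + length as)" "sat N ((!) (c @ as)) \<chi>"
  let ?\<chi> = "lift (length c) (length bs) \<chi>"
  have *: "sat N ((!) (c' @ bs @ as)) ?\<chi> = sat N ((!) (c' @ as)) \<chi>" if "length c' = length c" for c'
    using sat_lift[of \<chi> L c' as N bs] \<chi>(1) that by simp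
  have "?\<chi> \<in> formulas L (length c + length (bs @ as))"
    using lift_formulas[OF \<chi>(1) refl, of "length bs"] by (simp add: add.assoc)
  then have "has_family N (bs @ as) n (length c) ?\<chi> \<psi> k m"
    using assms \<chi> *[of c] by (simp add: fdiv_def)
  then show "has_family N as n (length c) \<chi> \<psi> k m"
    by (rule has_family_mono) (use * tuples_length in blast)
qed

lemma fdiv_teq:
  assumes "teq L N (c @ as) M (c' @ as')" "length c' = length c" "\<psi> \<in> formulas L (n + length c)"
    and "fdiv L N as n \<psi> c k"
  shows "fdiv L M as' n \<psi> c' k"
  unfolding fdiv_def
proof (intro ballI impI allI)
  fix \<chi> m assume \<chi>: "\<chi> \<in> formulas L (length c' + length as')" "sat M ((!) (c' @ as')) \<chi>"
  have t: "teq L N as M as'" using teq_suffix[OF assms(1)] assms(2) by simp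
  then have l: "length as' = length as" by (rule teq_length)
  then have "has_family N as n (length c) \<chi> \<psi> k m"
    using assms(4) \<chi> teq_sat[OF assms(1), of \<chi>] assms(2) by (simp add: fdiv_def)
  then show "has_family M as' n (length c') \<chi> \<psi> k m"
    using teq_has_family[OF t _ assms(3)] \<chi>(1) assms(2) l by simp
qed

text \<open>Takes the place of extracting an indiscernible sequence. The tuple \<open>c'\<close> has
  to satisfy the type of \<open>c\<close> over \<open>as\<close> and to avoid every
  \<open>\<chi>\<close> over \<open>e\<close> that lacks families of some size; then it divides over
  \<open>e\<close>. Finitely many of these conditions are met by a member of a long k-inconsistent
  family, since each such \<open>\<chi>\<close> catches only a bounded number of members.\<close>

lemma fdiv_extend:
  assumes sat: "omega_saturated L N" and e: "set e \<subseteq> univ N" and as: "set as \<subseteq> univ N"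
    and \<psi>: "\<psi> \<in> formulas L (n + length c)" and div: "fdiv L N as n \<psi> c k"
  obtains c' where "c' \<in> tuples N (length c)" "teq L N (c @ as) N (c' @ as)" "fdiv L N e n \<psi> c' k"
proof -
  define s where "s = length c"
  define \<Sigma>\<^sub>1 where "\<Sigma>\<^sub>1 = {\<chi> \<in> formulas L (s + length as). sat N ((!) (c @ as)) \<chi>}"
  define \<Sigma>\<^sub>2 where "\<Sigma>\<^sub>2 = {\<chi> \<in> formulas L (s + length e). \<exists>m. \<not> has_family N e n s \<chi> \<psi> k m}"
  let ?\<Sigma> = "lift s (length e) ` \<Sigma>\<^sub>1 \<union> Neg ` \<Sigma>\<^sub>2"
  have lift: "sat N ((!) (c' @ e @ as)) (lift s (length e) \<chi>) = sat N ((!) (c' @ as)) \<chi>"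
    if "\<chi> \<in> formulas L (s + length as)" "length c' = s" for c' \<chi>
    using sat_lift[of \<chi> L c' as N e] that by simp
  have app: "sat N ((!) (c' @ e @ as)) \<chi> = sat N ((!) (c' @ e)) \<chi>"
    if "\<chi> \<in> formulas L (s + length e)" "length c' = s" for c' \<chi>
    using sat_append[OF that(1), of "c' @ e" N as] that by simp
  have "\<exists>c'\<in>tuples N s. \<forall>\<chi>\<in>?\<Sigma>. sat N ((!) (c' @ e @ as)) \<chi>"
  proof (rule omega_saturated_realize[OF sat])
    show "set (e @ as) \<subseteq> univ N" using e as by simp
    have "lift s (length e) \<chi> \<in> formulas L (s + length (e @ as))"
      if "\<chi> \<in> formulas L (s + length as)" for \<chi>
      using lift_formulas[OF that refl, of "length e"] by (simp add: add.assoc)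
    moreover have "\<chi> \<in> formulas L (s + length (e @ as))" if "\<chi> \<in> formulas L (s + length e)" for \<chi>
      by (rule formulas_mono'[OF that]) simp
    ultimately show "?\<Sigma> \<subseteq> formulas L (s + length (e @ as))"
      by (auto simp: \<Sigma>\<^sub>1_def \<Sigma>\<^sub>2_def)
    fix \<Sigma>\<^sub>0 assume \<Sigma>\<^sub>0: "\<Sigma>\<^sub>0 \<subseteq> ?\<Sigma>" "finite \<Sigma>\<^sub>0"
    obtain X1 where X1: "X1 \<subseteq> \<Sigma>\<^sub>1" "finite X1" "\<Sigma>\<^sub>0 \<inter> lift s (length e) ` \<Sigma>\<^sub>1 = lift s (length e) ` X1"
      using finite_subset_image[of "\<Sigma>\<^sub>0 \<inter> lift s (length e) ` \<Sigma>\<^sub>1" "lift s (length e)" \<Sigma>\<^sub>1] \<Sigma>\<^sub>0(2) by auto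
    obtain X2 where X2: "X2 \<subseteq> \<Sigma>\<^sub>2" "finite X2" "\<Sigma>\<^sub>0 \<inter> Neg ` \<Sigma>\<^sub>2 = Neg ` X2"
      using finite_subset_image[of "\<Sigma>\<^sub>0 \<inter> Neg ` \<Sigma>\<^sub>2" Neg \<Sigma>\<^sub>2] \<Sigma>\<^sub>0(2) by auto
    have "\<forall>\<chi>\<in>X2. \<exists>m. \<not> has_family N e n s \<chi> \<psi> k m" using X2(1) by (auto simp: \<Sigma>\<^sub>2_def)
    then obtain \<mu> where \<mu>: "\<And>\<chi>. \<chi> \<in> X2 \<Longrightarrow> \<not> has_family N e n s \<chi> \<psi> k (\<mu> \<chi>)" by metis
    \<comment> \<open>Each \<open>\<chi>\<close> in \<open>X2\<close> holds at fewer than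
      \<open>\<mu> \<chi>\<close> members, so with one member more than the sum of these bounds some
      member satisfies none of them. The successor also covers empty \<open>X2\<close>.\<close>
    define m where "m = Suc (\<Sum>\<chi>\<in>X2. \<mu> \<chi>)"
    have b: "bigand X1 \<in> formulas L (s + length as)"
      using X1 by (intro bigand_formulas) (auto simp: \<Sigma>\<^sub>1_def)
    have "sat N ((!) (c @ as)) (bigand X1)"
      using X1(1) by (auto simp: sat_bigand[OF X1(2)] \<Sigma>\<^sub>1_def)
    then have "has_family N as n s (bigand X1) \<psi> k m"
      using div b by (simp add: fdiv_def s_def)
    then obtain cs where cs: "\<And>i. i < m \<Longrightarrow> cs i \<in> tuples N s"
      "\<And>i. i < m \<Longrightarrow> sat N ((!) (cs i @ as)) (bigand X1)" "kinconsistent N n \<psi> k m cs"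
      by (auto simp: has_family_def)
    define J where "J \<chi> = {i. i < m \<and> sat N ((!) (cs i @ e)) \<chi>}" for \<chi>
    have "card (J \<chi>) < \<mu> \<chi>" if "\<chi> \<in> X2" for \<chi>
    proof (rule ccontr)
      assume "\<not> card (J \<chi>) < \<mu> \<chi>"
      then have "has_family N e n s \<chi> \<psi> k (\<mu> \<chi>)"
        using cs(1) by (intro has_family_subfamily[OF _ cs(3), of "J \<chi>"]) (auto simp: J_def)
      with \<mu>[OF that] show False by simp
    qed
    then have "(\<Sum>\<chi>\<in>X2. card (J \<chi>)) \<le> (\<Sum>\<chi>\<in>X2. \<mu> \<chi>)"
      by (intro sum_mono) (auto intro: less_imp_le)
    moreover have "card (\<Union>\<chi>\<in>X2. J \<chi>) \<le> (\<Sum>\<chi>\<in>X2. card (J \<chi>))" by (rule card_UN_le[OF X2(2)])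
    ultimately have "card (\<Union>\<chi>\<in>X2. J \<chi>) < card {..<m}" by (simp add: m_def)
    moreover have "finite (\<Union>\<chi>\<in>X2. J \<chi>)" using X2(2) by (auto simp: J_def)
    ultimately have "\<not> {..<m} \<subseteq> (\<Union>\<chi>\<in>X2. J \<chi>)" by (metis card_mono not_less)
    then obtain i where i: "i < m" "\<And>\<chi>. \<chi> \<in> X2 \<Longrightarrow> \<not> sat N ((!) (cs i @ e)) \<chi>"
      by (auto simp: J_def)
    have len: "length (cs i) = s" using cs(1)[OF i(1)] by (rule tuples_length)
    have "sat N ((!) (cs i @ e @ as)) \<theta>" if \<theta>: "\<theta> \<in> \<Sigma>\<^sub>0" for \<theta>
    proof -
      consider (1) \<chi> where "\<theta> = lift s (length e) \<chi>" "\<chi> \<in> X1" | (2) \<chi> where "\<theta> = Neg \<chi>" "\<chi> \<in> X2"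
      proof -
        have "\<theta> \<in> lift s (length e) ` X1 \<or> \<theta> \<in> Neg ` X2"
          unfolding X1(3)[symmetric] X2(3)[symmetric] using \<Sigma>\<^sub>0(1) \<theta> by blast
        then show thesis by (elim disjE imageE) (use that in blast)+
      qed
      then show ?thesis
      proof cases
        case 1
        then show ?thesis
          using X1(1) cs(2)[OF i(1)] lift[OF _ len] by (auto simp: sat_bigand[OF X1(2)] \<Sigma>\<^sub>1_def)
      next
        case 2
        then show ?thesis using X2(1) i(2) app[OF _ len] by (auto simp: \<Sigma>\<^sub>2_def)
      qed
    qed
    with cs(1)[OF i(1)] show "\<exists>c\<in>tuples N s. \<forall>\<chi>\<in>\<Sigma>\<^sub>0. sat N ((!) (c @ e @ as)) \<chi>" by blast
  qed
  then obtain c' where c': "c' \<in> tuples N s" "\<And>\<chi>. \<chi> \<in> ?\<Sigma> \<Longrightarrow> sat N ((!) (c' @ e @ as)) \<chi>" by blast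
  have len: "length c' = s" using c'(1) by (rule tuples_length)
  have "teq L N (c @ as) N (c' @ as)"
  proof (rule teq_of_subtype)
    fix \<chi> assume "\<chi> \<in> formulas L (length (c @ as))" "sat N ((!) (c @ as)) \<chi>"
    then show "sat N ((!) (c' @ as)) \<chi>"
      using c'(2)[of "lift s (length e) \<chi>"] lift[OF _ len, of \<chi>] by (auto simp: \<Sigma>\<^sub>1_def s_def)
  qed (simp add: len s_def)
  moreover have "fdiv L N e n \<psi> c' k"
    unfolding fdiv_def
  proof (intro ballI impI allI)
    fix \<chi> m assume \<chi>: "\<chi> \<in> formulas L (length c' + length e)" "sat N ((!) (c' @ e)) \<chi>"
    then have "\<chi> \<notin> \<Sigma>\<^sub>2" using c'(2)[of "Neg \<chi>"] app[OF _ len, of \<chi>] len by auto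
    with \<chi> len show "has_family N e n (length c') \<chi> \<psi> k m" by (auto simp: \<Sigma>\<^sub>2_def)
  qed
  ultimately show thesis using c'(1) that by (simp add: s_def)
qed

section \<open>A rank without ordinals\<close>

text \<open>Iterating \<open>rank_step\<close> transfinitely from the empty family gives the families of sets of
  D-rank less than \<open>\<alpha>\<close>.\<close>

definition drops_over :: "('f, 'r) language \<Rightarrow> ('f, 'r, 'a) fostruct \<Rightarrow> nat \<Rightarrow> 'a list set set
    \<Rightarrow> 'a list \<Rightarrow> 'a list set \<Rightarrow> bool" where
  "drops_over L N n I e X \<longleftrightarrow> set e \<subseteq> univ N \<and>
     (\<forall>\<psi> c k. set c \<subseteq> univ N \<and> \<psi> \<in> formulas L (n + length c) \<and> k > 0 \<and> fdiv L N e n \<psi> c k \<longrightarrow>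
        X \<inter> solset N n (\<psi>, c) \<in> I)"

text \<open>The clause for the empty set starts the iteration: a contradictory formula divides over
  every \<open>e\<close>, so without the clause the empty family would already be a fixed
  point.\<close>

definition rank_step :: "('f, 'r) language \<Rightarrow> ('f, 'r, 'a) fostruct \<Rightarrow> nat \<Rightarrow> 'a list set set
    \<Rightarrow> 'a list set set" where
  "rank_step L N n I = {X. X = {} \<or> (\<exists>e. drops_over L N n I e X)}"

lemma drops_overD:
  assumes "drops_over L N n I e X"
  shows "set e \<subseteq> univ N"
    and "set c \<subseteq> univ N \<Longrightarrow> \<psi> \<in> formulas L (n + length c) \<Longrightarrow> k > 0 \<Longrightarrow> fdiv L N e n \<psi> c k
      \<Longrightarrow> X \<inter> solset N n (\<psi>, c) \<in> I"
  using assms unfolding drops_over_def by blast+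

lemma drops_overI:
  assumes "set e \<subseteq> univ N" "\<And>\<psi> c k. set c \<subseteq> univ N \<Longrightarrow> \<psi> \<in> formulas L (n + length c)
    \<Longrightarrow> k > 0 \<Longrightarrow> fdiv L N e n \<psi> c k \<Longrightarrow> X \<inter> solset N n (\<psi>, c) \<in> I"
  shows "drops_over L N n I e X"
  unfolding drops_over_def using assms by blast

lemma mono_rank_step: "monotone (\<le>) (\<le>) (rank_step L N n)"
proof (rule monotoneI, rule subsetI)
  fix I J X assume IJ: "I \<subseteq> J" and X: "X \<in> rank_step L N n I"
  have "drops_over L N n J e X" if "drops_over L N n I e X" for e
    using drops_overD[OF that] IJ by (intro drops_overI) blast+
  with X show "X \<in> rank_step L N n J" by (auto simp: rank_step_def)
qed

text \<open>Monotonicity, subadditivity and type invariance of the rank, stated for one stage. The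
  empty set need not belong to \<open>I\<close>, since the iteration begins with the empty family;
  this is why \<open>insert {} I\<close> occurs later.\<close>

definition rank_ideal :: "('f, 'r) language \<Rightarrow> ('f, 'r, 'a) fostruct \<Rightarrow> nat \<Rightarrow> 'a list set set
    \<Rightarrow> bool" where
  "rank_ideal L N n I \<longleftrightarrow>
     (\<forall>X\<in>I. \<forall>Y. Y \<subseteq> X \<longrightarrow> Y \<in> I) \<and> (\<forall>X\<in>I. \<forall>Y\<in>I. X \<union> Y \<in> I) \<and>
     (\<forall>\<phi> as bs. \<phi> \<in> formulas L (n + length as) \<and> set as \<subseteq> univ N \<and> set bs \<subseteq> univ N \<and>
        teq L N as N bs \<and> solset N n (\<phi>, as) \<in> I \<longrightarrow> solset N n (\<phi>, bs) \<in> I)"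

lemma rank_idealD:
  assumes "rank_ideal L N n I"
  shows "X \<in> I \<Longrightarrow> Y \<subseteq> X \<Longrightarrow> Y \<in> I"
    and "X \<in> I \<Longrightarrow> Y \<in> I \<Longrightarrow> X \<union> Y \<in> I"
    and "\<phi> \<in> formulas L (n + length as) \<Longrightarrow> set as \<subseteq> univ N \<Longrightarrow> set bs \<subseteq> univ N \<Longrightarrow>
      teq L N as N bs \<Longrightarrow> solset N n (\<phi>, as) \<in> I \<Longrightarrow> solset N n (\<phi>, bs) \<in> I"
  using assms unfolding rank_ideal_def by simp_all

text \<open>For unions, the two bases \<open>e\<close> and \<open>e'\<close> are concatenated. For
  invariance, \<open>e\<close> is carried to some \<open>e'\<close> over \<open>bs\<close>; an
  instance at \<open>c'\<close> dividing over \<open>e'\<close> is pulled back to a \<open>c\<close>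
  dividing over \<open>e\<close>, and invariance of \<open>I\<close> returns the resulting
  intersection to \<open>c'\<close>.\<close>

lemma rank_ideal_rank_step:
  assumes sat: "omega_saturated L N" and I: "rank_ideal L N n I"
  shows "rank_ideal L N n (rank_step L N n I)"
  unfolding rank_ideal_def
proof (intro conjI ballI allI impI)
  fix X assume X: "X \<in> rank_step L N n I"
  show "Y \<in> rank_step L N n I" if YX: "Y \<subseteq> X" for Y
  proof -
    have "drops_over L N n I e Y" if "drops_over L N n I e X" for e
    proof (rule drops_overI[OF drops_overD(1)[OF that]])
      fix \<psi> c k
      assume "set c \<subseteq> univ N" "\<psi> \<in> formulas L (n + length c)" "k > 0" "fdiv L N e n \<psi> c k"
      then have "X \<inter> solset N n (\<psi>, c) \<in> I" by (rule drops_overD(2)[OF that])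
      then show "Y \<inter> solset N n (\<psi>, c) \<in> I" by (rule rank_idealD(1)[OF I]) (use YX in blast)
    qed
    with X YX show ?thesis by (auto simp: rank_step_def)
  qed
  fix Y assume Y: "Y \<in> rank_step L N n I"
  have "drops_over L N n I (e @ e') (X \<union> Y)"
    if e: "drops_over L N n I e X" and e': "drops_over L N n I e' Y" for e e'
  proof (rule drops_overI)
    show "set (e @ e') \<subseteq> univ N" using drops_overD(1)[OF e] drops_overD(1)[OF e'] by simp
    fix \<psi> c k
    assume *: "set c \<subseteq> univ N" "\<psi> \<in> formulas L (n + length c)" "k > 0" "fdiv L N (e @ e') n \<psi> c k"
    have "X \<inter> solset N n (\<psi>, c) \<in> I"
      using drops_overD(2)[OF e *(1-3)] fdiv_prefix[OF *(4)] by blast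
    moreover have "Y \<inter> solset N n (\<psi>, c) \<in> I"
      using drops_overD(2)[OF e' *(1-3)] fdiv_suffix[OF *(4)] by blast
    ultimately show "(X \<union> Y) \<inter> solset N n (\<psi>, c) \<in> I"
      using rank_idealD(2)[OF I] by (simp add: Int_Un_distrib2)
  qed
  with X Y show "X \<union> Y \<in> rank_step L N n I" by (auto simp: rank_step_def)
next
  fix \<phi> as bs
  assume *: "\<phi> \<in> formulas L (n + length as) \<and> set as \<subseteq> univ N \<and> set bs \<subseteq> univ N \<and>
    teq L N as N bs \<and> solset N n (\<phi>, as) \<in> rank_step L N n I"
  then have \<phi>: "\<phi> \<in> formulas L (n + length as)" and t: "teq L N as N bs"
    and as: "set as \<subseteq> univ N" and bs: "set bs \<subseteq> univ N" by auto
  have lbs: "length bs = length as" using t by (rule teq_length)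
  show "solset N n (\<phi>, bs) \<in> rank_step L N n I"
  proof (cases "solset N n (\<phi>, as) = {}")
    case True
    then show ?thesis using teq_solset_empty[OF t \<phi>] by (simp add: rank_step_def)
  next
    case False
    then obtain e where d: "drops_over L N n I e (solset N n (\<phi>, as))"
      using * by (auto simp: rank_step_def)
    note e = drops_overD(1)[OF d] and drop = drops_overD(2)[OF d]
    obtain e' where e': "e' \<in> tuples N (length e)" "teq L N (e @ as) N (e' @ bs)"
      using omega_saturated_extend[OF sat t tuplesI[OF e refl] bs] by blast
    have le': "length e' = length e" using e'(1) by (rule tuples_length)
    have e'u: "set e' \<subseteq> univ N" using e'(1) by (simp add: tuples_def)
    have "solset N n (\<phi>, bs) \<inter> solset N n (\<psi>, c') \<in> I"
      if c': "set c' \<subseteq> univ N" "\<psi> \<in> formulas L (n + length c')" "k > 0" "fdiv L N e' n \<psi> c' k"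
      for \<psi> c' k
    proof -
      have eas: "set (e @ as) \<subseteq> univ N" using e as by simp
      obtain c where c: "c \<in> tuples N (length c')" "teq L N (c' @ e' @ bs) N (c @ e @ as)"
        using omega_saturated_extend[OF sat teq_sym[OF e'(2)] tuplesI[OF c'(1) refl] eas] by blast
      have lc: "length c = length c'" using c(1) by (rule tuples_length)
      have cu: "set c \<subseteq> univ N" using c(1) by (simp add: tuples_def)
      have "teq L N (c' @ e') N (c @ e)"
        using teq_prefix[of L N "c' @ e'" bs N "c @ e" as] c(2) lc le' by simp
      then have "fdiv L N e n \<psi> c k"
        using c'(2,4) lc by (intro fdiv_teq[of L N c' e' N c e])
      then have "solset N n (\<phi>, as) \<inter> solset N n (\<psi>, c) \<in> I"
        using drop[OF cu _ c'(3)] c'(2) lc by simp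
      then have m: "solset N n (Conj (lift n (length c) \<phi>) \<psi>, c @ as) \<in> I"
        using solset_meet[OF \<phi>, of \<psi> c N] c'(2) lc by simp
      have "teq L N (c @ as) N (c' @ bs)"
        using teq_drop_middle[OF teq_sym[OF c(2)]] lc le' by simp
      then have "solset N n (Conj (lift n (length c) \<phi>) \<psi>, c' @ bs) \<in> I"
        using rank_idealD(3)[OF I meet_formulas[OF \<phi>, of \<psi> c] _ _ _ m] c'(1,2) cu as bs lc by simp
      then show ?thesis
        using solset_meet[of \<phi> L n bs \<psi> c' N] \<phi> c'(2) lc lbs by simp
    qed
    then have "drops_over L N n I e' (solset N n (\<phi>, bs))" by (intro drops_overI[OF e'u])
    then show ?thesis by (auto simp: rank_step_def)
  qed
qed

text \<open>The base \<open>e\<close> given by the rank may be unrelated to \<open>as\<close>. So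
  \<open>c\<close> is first replaced by a conjugate over \<open>as\<close> that divides over
  \<open>e\<close>; that intersection lies in \<open>I\<close>, and type invariance gives the same
  for \<open>c\<close>.\<close>

lemma rank_step_drop:
  assumes sat: "omega_saturated L N" and I: "rank_ideal L N n I"
    and \<phi>: "\<phi> \<in> formulas L (n + length as)" and as: "set as \<subseteq> univ N"
    and X: "solset N n (\<phi>, as) \<in> rank_step L N n I"
    and \<psi>: "\<psi> \<in> formulas L (n + length c)" and c: "set c \<subseteq> univ N"
    and k: "k > 0" and div: "fdiv L N as n \<psi> c k"
  shows "solset N n (\<phi>, as) \<inter> solset N n (\<psi>, c) \<in> insert {} I"
proof (cases "solset N n (\<phi>, as) = {}")
  case False
  then obtain e where d: "drops_over L N n I e (solset N n (\<phi>, as))"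
    using X by (auto simp: rank_step_def)
  obtain c' where c': "c' \<in> tuples N (length c)" "teq L N (c @ as) N (c' @ as)" "fdiv L N e n \<psi> c' k"
    using fdiv_extend[OF sat drops_overD(1)[OF d] as \<psi> div] by blast
  have lc: "length c' = length c" using c'(1) by (rule tuples_length)
  have cu: "set c' \<subseteq> univ N" using c'(1) by (simp add: tuples_def)
  have "solset N n (\<phi>, as) \<inter> solset N n (\<psi>, c') \<in> I" using drops_overD(2)[OF d cu _ k c'(3)] \<psi> lc by simp
  then have m: "solset N n (Conj (lift n (length c') \<phi>) \<psi>, c' @ as) \<in> I"
    using solset_meet[OF \<phi>, of \<psi> c' N] \<psi> lc by simp
  have "solset N n (Conj (lift n (length c') \<phi>) \<psi>, c @ as) \<in> I"
    using rank_idealD(3)[OF I meet_formulas[OF \<phi>, of \<psi> c'] _ _ teq_sym[OF c'(2)] m] \<psi> c cu as lc by simp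
  then show ?thesis using solset_meet[OF \<phi> \<psi>, of N] lc by simp
qed simp

section \<open>Sets with ordinal rank, and forking types\<close>

definition small :: "('f, 'r) language \<Rightarrow> ('f, 'r, 'a) fostruct \<Rightarrow> nat \<Rightarrow> 'a list set set" where
  "small L N n = ccpo_class.fixp (rank_step L N n)"

lemma small_unfold: "small L N n = rank_step L N n (small L N n)"
  unfolding small_def by (rule ccpo_class.fixp_unfold[OF mono_rank_step])

lemma not_small:
  assumes "X \<notin> small L N n" "set e \<subseteq> univ N"
  shows "X \<noteq> {}" and "\<exists>\<psi> c k. set c \<subseteq> univ N \<and> \<psi> \<in> formulas L (n + length c) \<and> k > 0 \<and>
    fdiv L N e n \<psi> c k \<and> X \<inter> solset N n (\<psi>, c) \<notin> small L N n"
proof -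
  have X: "X \<notin> rank_step L N n (small L N n)" using assms(1) small_unfold by blast
  then show "X \<noteq> {}" by (auto simp: rank_step_def)
  have "\<not> drops_over L N n (small L N n) e X" using X by (auto simp: rank_step_def)
  then show "\<exists>\<psi> c k. set c \<subseteq> univ N \<and> \<psi> \<in> formulas L (n + length c) \<and> k > 0 \<and>
    fdiv L N e n \<psi> c k \<and> X \<inter> solset N n (\<psi>, c) \<notin> small L N n"
    using assms(2) unfolding drops_over_def by blast
qed

text \<open>The rank arguments treat one formula with one parameter tuple, while the members of a
  type carry different tuples; concatenation bridges this.\<close>

lemma finite_type_formula:
  assumes "finite q" "q \<subseteq> pformulas L B n"
  shows "\<exists>\<phi> as. \<phi> \<in> formulas L (n + length as) \<and> set as \<subseteq> B \<and>
    solset N n (\<phi>, as) = realizations N n q"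
  using assms
proof (induction q)
  case empty
  have "solset N n (truth, []) = realizations N n {}"
    by (auto simp: realizations_def mem_solset)
  moreover have "truth \<in> formulas L (n + length [])" by simp
  ultimately show ?case by (metis empty_set empty_subsetI)
next
  case (insert \<theta> q)
  obtain \<psi> c where \<theta>: "\<theta> = (\<psi>, c)" by (cases \<theta>)
  obtain \<phi> as where IH: "\<phi> \<in> formulas L (n + length as)" "set as \<subseteq> B"
    "solset N n (\<phi>, as) = realizations N n q" using insert by auto
  have \<psi>: "\<psi> \<in> formulas L (n + length c)" "set c \<subseteq> B"
    using insert.prems by (auto simp: \<theta> pformulas_iff)
  have "solset N n (Conj (lift n (length c) \<phi>) \<psi>, c @ as) = realizations N n (insert \<theta> q)"
    unfolding solset_meet[OF IH(1) \<psi>(1)] IH(3) \<theta> by (auto simp: realizations_def mem_solset)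
  moreover have "set (c @ as) \<subseteq> B" using IH \<psi> by simp
  ultimately show ?case using meet_formulas[OF IH(1) \<psi>(1)] by blast
qed

text \<open>The descent is run as an induction: no stage contains a finite approximation of
  \<open>p\<close>. If one entered at a step, forking over its own parameters would cover a finer
  approximation by finitely many pieces of the previous stage, and closure under unions would put
  the finer one there.\<close>

lemma forking_not_small:
  assumes sat: "omega_saturated L N" and B: "B \<subseteq> univ N" and p: "partial_type L N B n p"
    and forks: "\<And>A. finite A \<Longrightarrow> A \<subseteq> B \<Longrightarrow> forks L N A n p"
  shows "tuples N n \<notin> small L N n"
proof -
  define approx where "approx \<phi> as \<longleftrightarrow> \<phi> \<in> formulas L (n + length as) \<and> set as \<subseteq> B \<and>
    (\<exists>q. finite q \<and> q \<subseteq> p \<and> solset N n (\<phi>, as) = realizations N n q)" for \<phi> as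
  have sub: "p \<subseteq> pformulas L B n" using p by (simp add: partial_type_def)
  define P where "P I \<longleftrightarrow> rank_ideal L N n I \<and> (\<forall>\<phi> as. approx \<phi> as \<longrightarrow> solset N n (\<phi>, as) \<notin> I)" for I
  have "P (ccpo_class.fixp (rank_step L N n))"
  proof (rule ccpo_class.fixp_induct[OF _ mono_rank_step])
    \<comment> \<open>Two stages of a chain are comparable, so closure under unions passes to the
      union of the chain. It need not pass to the union of an arbitrary set of ideals, which is why
      the induction follows the iteration.\<close>
    show "ccpo.admissible Sup (\<le>) P"
    proof (rule ccpo.admissibleI)
      fix S :: "'c list set set set"
      assume ch: "Complete_Partial_Order.chain (\<le>) S" and S: "S \<noteq> {}" "\<forall>I\<in>S. P I"
      have "rank_ideal L N n (\<Union>S)"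
        unfolding rank_ideal_def
      proof (intro conjI ballI allI impI)
        fix X assume "X \<in> \<Union>S"
        then obtain I where I: "I \<in> S" "X \<in> I" by blast
        then have ri: "rank_ideal L N n I" using S by (simp add: P_def)
        show "Y \<in> \<Union>S" if "Y \<subseteq> X" for Y
          using rank_idealD(1)[OF ri I(2) that] I(1) by blast
        fix Y assume "Y \<in> \<Union>S"
        then obtain J where J: "J \<in> S" "Y \<in> J" by blast
        then have rj: "rank_ideal L N n J" using S by (simp add: P_def)
        have "I \<subseteq> J \<or> J \<subseteq> I" using ch I(1) J(1) by (auto simp: chain_def)
        then have "X \<union> Y \<in> I \<or> X \<union> Y \<in> J"
          using rank_idealD(2)[OF ri I(2)] rank_idealD(2)[OF rj _ J(2)] I(2) J(2) by blast
        then show "X \<union> Y \<in> \<Union>S" using I(1) J(1) by blast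
      next
        fix \<phi> as bs
        assume *: "\<phi> \<in> formulas L (n + length as) \<and> set as \<subseteq> univ N \<and> set bs \<subseteq> univ N \<and>
          teq L N as N bs \<and> solset N n (\<phi>, as) \<in> \<Union>S"
        then obtain I where I: "I \<in> S" "solset N n (\<phi>, as) \<in> I" by blast
        then have "rank_ideal L N n I" using S by (simp add: P_def)
        from rank_idealD(3)[OF this _ _ _ _ I(2)] * show "solset N n (\<phi>, bs) \<in> \<Union>S"
          using I(1) by blast
      qed
      then show "P (\<Union>S)" using S by (simp add: P_def)
    qed
    show "P (Sup {})" by (simp add: P_def rank_ideal_def)
    fix I assume "P I"
    then have I: "rank_ideal L N n I" "\<And>\<phi> as. approx \<phi> as \<Longrightarrow> solset N n (\<phi>, as) \<notin> I"
      by (auto simp: P_def)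
    have "solset N n (\<phi>, as) \<notin> rank_step L N n I" if a: "approx \<phi> as" for \<phi> as
    proof
      assume X: "solset N n (\<phi>, as) \<in> rank_step L N n I"
      have \<phi>: "\<phi> \<in> formulas L (n + length as)" "set as \<subseteq> B" using a by (auto simp: approx_def)
      have asu: "set as \<subseteq> univ N" using \<phi>(2) B by blast
      obtain q where q: "finite q" "q \<subseteq> p" "solset N n (\<phi>, as) = realizations N n q"
        using a by (auto simp: approx_def)
      \<comment> \<open>The base is the parameter set of the current approximation, since
        \<open>rank_step_drop\<close> needs dividing over exactly those parameters.\<close>
      obtain \<Psi> q' where \<Psi>: "finite \<Psi>" "\<Psi> \<subseteq> pformulas L (univ N) n"
        "\<And>\<psi>. \<psi> \<in> \<Psi> \<Longrightarrow> divides L N (set as) n \<psi>"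
        and q': "finite q'" "q' \<subseteq> p" "realizations N n q' \<subseteq> (\<Union>\<psi>\<in>\<Psi>. solset N n \<psi>)"
        using forks[of "set as"] \<phi>(2) unfolding forks_def entails_def by auto
      have qq: "finite (q \<union> q')" "q \<union> q' \<subseteq> p" using q q' by auto
      then have "q \<union> q' \<subseteq> pformulas L B n" using sub by blast
      then obtain \<phi>' as' where \<phi>': "\<phi>' \<in> formulas L (n + length as')" "set as' \<subseteq> B"
        "solset N n (\<phi>', as') = realizations N n (q \<union> q')"
        using finite_type_formula[OF qq(1), of L B n N] by blast
      have ap: "approx \<phi>' as'" unfolding approx_def using \<phi>' qq by blast
      \<comment> \<open>Consistency of \<open>p\<close> will exclude the alternative
        \<open>{}\<close> in \<open>insert {} I\<close>.\<close>
      have "realizations N n (q \<union> q') \<noteq> {}" using p qq by (auto simp: partial_type_def)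
      then have nonempty: "solset N n (\<phi>', as') \<noteq> {}" using \<phi>'(3) by simp
      have piece: "solset N n (\<phi>, as) \<inter> solset N n \<psi> \<in> insert {} I" if \<psi>: "\<psi> \<in> \<Psi>" for \<psi>
      proof -
        obtain \<chi> c where \<chi>: "\<psi> = (\<chi>, c)" by (cases \<psi>)
        have "(\<chi>, c) \<in> pformulas L (univ N) n" using \<Psi>(2) that \<chi> by blast
        then have "\<chi> \<in> formulas L (n + length c)" "set c \<subseteq> univ N" by (simp_all add: pformulas_iff)
        moreover obtain k where "k > 0" "fdiv L N as n \<chi> c k"
          using divides_imp_fdiv \<Psi>(3)[OF \<psi>] \<chi> by blast
        ultimately show ?thesis unfolding \<chi> by (intro rank_step_drop[OF sat I(1) \<phi>(1) asu X])
      qed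
      have "(\<Union>\<psi>\<in>\<Psi>. solset N n (\<phi>, as) \<inter> solset N n \<psi>) \<in> insert {} I"
        using \<Psi>(1) piece
      proof (induction \<Psi>)
        case (insert \<psi> \<Psi>)
        then have "solset N n (\<phi>, as) \<inter> solset N n \<psi> \<in> insert {} I"
          "(\<Union>\<psi>\<in>\<Psi>. solset N n (\<phi>, as) \<inter> solset N n \<psi>) \<in> insert {} I" by auto
        then have "(solset N n (\<phi>, as) \<inter> solset N n \<psi>) \<union>
            (\<Union>\<psi>\<in>\<Psi>. solset N n (\<phi>, as) \<inter> solset N n \<psi>) \<in> insert {} I"
          using rank_idealD(2)[OF I(1)] by (elim insertE) auto
        then show ?case by simp
      qed simp
      moreover have "solset N n (\<phi>', as') \<subseteq> (\<Union>\<psi>\<in>\<Psi>. solset N n (\<phi>, as) \<inter> solset N n \<psi>)"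
      proof -
        have "realizations N n (q \<union> q') = realizations N n q \<inter> realizations N n q'"
          by (auto simp: realizations_def)
        then show ?thesis unfolding \<phi>'(3) q(3) using q'(3) by blast
      qed
      ultimately have "solset N n (\<phi>', as') \<in> I"
        using nonempty rank_idealD(1)[OF I(1)] by blast
      with I(2)[OF ap] show False by simp
    qed
    with rank_ideal_rank_step[OF sat I(1)] show "P (rank_step L N n I)" by (simp add: P_def)
  qed
  moreover obtain \<phi> as where "\<phi> \<in> formulas L (n + length as)" "set as \<subseteq> B"
    "solset N n (\<phi>, as) = realizations N n {}"
    using finite_type_formula[of "{}" L B n N] by auto
  moreover have "realizations N n {} = tuples N n" by (simp add: realizations_def)
  ultimately show ?thesis unfolding small_def P_def approx_def by (metis empty_subsetI finite.emptyI)
qed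

section \<open>Ultraproducts of finite structures\<close>

lemma urep_in_uclass:
  assumes "c \<in> uprod C U X"
  shows "urep c \<in> c"
proof -
  obtain x where "c = uclass C U X x" "x \<in> Pi\<^sub>E C X" using assms by (auto simp: uprod_def)
  then have "x \<in> c" by (simp add: uclass_def)
  then show ?thesis unfolding urep_def by (rule someI[of "\<lambda>x. x \<in> c"])
qed

lemma urep_PiE:
  assumes "c \<in> uprod C U X"
  shows "urep c \<in> Pi\<^sub>E C X"
  using urep_in_uclass[OF assms] assms by (auto simp: uprod_def uclass_def)

lemma uclass_cong:
  assumes "eventually (\<lambda>i. x i = y i) U"
  shows "uclass C U X x = uclass C U X y"
proof -
  have "eventually (\<lambda>i. z i = x i) U \<longleftrightarrow> eventually (\<lambda>i. z i = y i) U" for z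
    using assms by (auto elim: eventually_elim2)
  then show ?thesis by (simp add: uclass_def)
qed

lemma uclass_urep:
  assumes "c \<in> uprod C U X"
  shows "uclass C U X (urep c) = c"
proof -
  obtain x where x: "c = uclass C U X x" using assms by (auto simp: uprod_def)
  have "eventually (\<lambda>i. urep c i = x i) U"
    using urep_in_uclass[OF assms] by (simp add: x uclass_def)
  then show ?thesis using x uclass_cong by metis
qed

lemma uprod_eq_iff:
  assumes "c \<in> uprod C U X" "d \<in> uprod C U X"
  shows "c = d \<longleftrightarrow> eventually (\<lambda>i. urep c i = urep d i) U"
proof
  assume "eventually (\<lambda>i. urep c i = urep d i) U"
  then have "uclass C U X (urep c) = uclass C U X (urep d)" by (rule uclass_cong)
  then show "c = d" using assms by (simp add: uclass_urep)
qed simp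

text \<open>Values outside \<open>C\<close> are irrelevant: restricting \<open>x\<close> to
  \<open>C\<close> makes it extensional and leaves its class unchanged.\<close>

lemma uclass_representative:
  assumes "eventually (\<lambda>i. i \<in> C) U" "\<And>i. i \<in> C \<Longrightarrow> x i \<in> X i"
  shows "uclass C U X x \<in> uprod C U X" "eventually (\<lambda>i. urep (uclass C U X x) i = x i) U"
proof -
  have "eventually (\<lambda>i. x i = restrict x C i) U"
    using assms(1) by (rule eventually_mono) simp
  then have "uclass C U X x = uclass C U X (restrict x C)" by (rule uclass_cong)
  moreover have "restrict x C \<in> Pi\<^sub>E C X" using assms(2) by auto
  ultimately show *: "uclass C U X x \<in> uprod C U X" by (auto simp: uprod_def)
  show "eventually (\<lambda>i. urep (uclass C U X x) i = x i) U"
    using urep_in_uclass[OF *] by (simp add: uclass_def)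
qed

text \<open>Double counting: no point of \<open>D\<close> lies in more than \<open>k\<close> of the
  sets, so their sizes add up to at most \<open>k\<close> times that of \<open>D\<close>. Among
  \<open>(j + 1) * k\<close> sets the average is then at most the size of \<open>D\<close> divided
  by \<open>j + 1\<close>.\<close>

lemma count_kinconsistent:
  assumes inc: "kinconsistent K n \<psi> k (Suc j * k) cs" and k: "k > 0"
    and D: "finite D" "D \<subseteq> tuples K n"
  shows "\<exists>i<Suc j * k. Suc j * card (D \<inter> solset K n (\<psi>, cs i)) \<le> card D"
proof (rule ccontr)
  define m where "m = Suc j * k"
  let ?a = "\<lambda>i. card (D \<inter> solset K n (\<psi>, cs i))"
  assume "\<not> (\<exists>i<Suc j * k. Suc j * ?a i \<le> card D)"
  then have "(\<Sum>i<m. card D) < (\<Sum>i<m. Suc j * ?a i)"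
    using k by (intro sum_strict_mono) (auto simp: m_def not_le lessThan_empty_iff)
  then have *: "m * card D < Suc j * (\<Sum>i<m. ?a i)" by (simp only: sum_distrib_left) simp
  have "(\<Sum>i<m. ?a i) = (\<Sum>i<m. \<Sum>x\<in>D. if x \<in> solset K n (\<psi>, cs i) then 1 else 0)"
    unfolding card_eq_sum by (rule sum.cong[OF refl]) (rule sum.inter_restrict[OF D(1)])
  also have "\<dots> = (\<Sum>x\<in>D. \<Sum>i<m. if x \<in> solset K n (\<psi>, cs i) then 1 else 0)"
    by (rule sum.swap)
  also have "\<dots> = (\<Sum>x\<in>D. card {i \<in> {..<m}. x \<in> solset K n (\<psi>, cs i)})"
    unfolding card_eq_sum by (rule sum.cong[OF refl]) (rule sum.inter_filter[symmetric], simp)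
  also have "\<dots> \<le> (\<Sum>x\<in>D. k)"
  proof (rule sum_mono)
    fix x assume x: "x \<in> D"
    show "card {i \<in> {..<m}. x \<in> solset K n (\<psi>, cs i)} \<le> k"
    proof (rule ccontr)
      assume "\<not> ?thesis"
      then have "k \<le> card {i \<in> {..<m}. x \<in> solset K n (\<psi>, cs i)}" by simp
      then obtain I where I: "I \<subseteq> {i \<in> {..<m}. x \<in> solset K n (\<psi>, cs i)}" "card I = k"
        by (rule obtain_subset_with_card_n)
      then have "\<not> (\<exists>xs\<in>tuples K n. \<forall>i\<in>I. sat K ((!) (xs @ cs i)) \<psi>)"
        using inc unfolding kinconsistent_def m_def by blast
      then show False using I(1) x D(2) by (auto simp: mem_solset)
    qed
  qed
  finally have "Suc j * (\<Sum>i<m. ?a i) \<le> Suc j * (card D * k)" by (intro mult_le_mono2) simp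
  with * have "m * card D < Suc j * (card D * k)" by (rule less_le_trans)
  then show False by (simp add: m_def algebra_simps)
qed

text \<open>The combinatorial core of saturation. The conditions are nested, so in a finite set one
  element meets all that are attainable: one that lasts longest. Finiteness of the factors thus
  replaces the usual diagonal along index sets decreasing to the empty set.\<close>

lemma finite_diagonal:
  assumes "finite A" "A \<noteq> {}" and anti: "\<And>i j d. G j d \<Longrightarrow> i \<le> j \<Longrightarrow> G (i :: nat) d"
  shows "\<exists>d\<in>A. \<forall>j. (\<exists>d'\<in>A. G j d') \<longrightarrow> G j d"
  using assms(1,2)
proof (induction A rule: finite_ne_induct)
  case (insert x A)
  then obtain d where d: "d \<in> A" "\<And>j d'. d' \<in> A \<Longrightarrow> G j d' \<Longrightarrow> G j d" by blast
  show ?case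
  proof (cases "\<forall>j. G j x \<longrightarrow> G j d")
    case True
    with d show ?thesis by blast
  next
    case False
    then obtain j where j: "G j x" "\<not> G j d" by blast
    have "G i x" if "d' \<in> insert x A" "G i d'" for i d'
    proof (cases "i \<le> j")
      case False
      then have "\<not> G i d" using anti[of i d j] j(2) by auto
      then have "d' = x" using d(2) that by blast
      then show ?thesis using that by simp
    qed (use anti j in blast)
    then show ?thesis by blast
  qed
qed simp

lemma finite_tuples: "finite (univ N) \<Longrightarrow> finite (tuples N r)"
  using finite_lists_length_eq[of "univ N" r] by (simp add: tuples_def conj_commute)

lemma solset_diff:
  assumes "\<phi> \<in> formulas L (n + length as)" "\<psi> \<in> formulas L (n + length c)"
  shows "solset N n (Conj (lift n (length c) \<phi>) (Neg \<psi>), c @ as)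
    = solset N n (\<phi>, as) - solset N n (\<psi>, c)"
proof -
  have "solset N n (Neg \<psi>, c) = tuples N n - solset N n (\<psi>, c)" by (auto simp: mem_solset)
  moreover have "solset N n (\<phi>, as) \<subseteq> tuples N n" by (auto simp: mem_solset)
  moreover have "Neg \<psi> \<in> formulas L (n + length c)" using assms(2) by simp
  ultimately show ?thesis using solset_meet[OF assms(1), of "Neg \<psi>" c N] by blast
qed

abbreviation coord :: "('f, 'r, 'a) fostruct \<Rightarrow> ('f, 'r, 'a) uelem list \<Rightarrow> 'a list" where
  "coord K cs \<equiv> map (\<lambda>c. urep c K) cs"

section \<open>Los's theorem and its consequences for definable sets\<close>

locale finite_ultraproduct =
  fixes L :: "('f, 'r) language" and C :: "('f, 'r, 'a) fostruct set"
    and U :: "('f, 'r, 'a) fostruct filter"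
  assumes structures: "\<And>N. N \<in> C \<Longrightarrow> is_structure L N \<and> finite (univ N)"
    and ultrafilter: "ultrafilter_on C U"
begin

abbreviation "M \<equiv> ultraproduct C U"

lemma eventually_C: "eventually (\<lambda>N. N \<in> C) U"
  using ultrafilter by (simp add: ultrafilter_on_def)

lemma eventually_False: "\<not> eventually (\<lambda>_. False) U"
  using ultrafilter by (simp add: ultrafilter_on_def trivial_limit_def)

lemma eventually_Not: "eventually (\<lambda>N. \<not> P N) U \<longleftrightarrow> \<not> eventually P U"
proof
  assume "eventually (\<lambda>N. \<not> P N) U"
  show "\<not> eventually P U"
  proof
    assume "eventually P U"
    with \<open>eventually (\<lambda>N. \<not> P N) U\<close> have "eventually (\<lambda>_. False) U" by eventually_elim simp
    then show False using eventually_False by simp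
  qed
qed (use ultrafilter in \<open>auto simp: ultrafilter_on_def\<close>)

lemma univ_M: "univ M = uprod C U univ"
  by (simp add: ultraproduct_def)

lemma urep_univ: "c \<in> univ M \<Longrightarrow> K \<in> C \<Longrightarrow> urep c K \<in> univ K"
  using urep_PiE[of c C U univ] by (auto simp: univ_M)

lemma coord_univ: "set cs \<subseteq> univ M \<Longrightarrow> K \<in> C \<Longrightarrow> set (coord K cs) \<subseteq> univ K"
  using urep_univ by auto

lemma val_ultraproduct:
  assumes "wf_tm L t" "\<And>v. v \<in> fv_tm t \<Longrightarrow> e v \<in> univ M"
  shows "val M e t \<in> univ M \<and>
    eventually (\<lambda>K. urep (val M e t) K = val K (\<lambda>v. urep (e v) K) t) U"
  using assms
proof (induction t)
  case (Fn f ts)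
  let ?x = "\<lambda>K. fn K f (coord K (map (val M e) ts))"
  have IH: "val M e t \<in> univ M"
    "eventually (\<lambda>K. urep (val M e t) K = val K (\<lambda>v. urep (e v) K) t) U" if "t \<in> set ts" for t
    using Fn.IH[OF that] Fn.prems that by auto
  have val: "val M e (Fn f ts) = uclass C U univ ?x"
    by (simp add: ultraproduct_def)
  have x: "?x K \<in> univ K" if "K \<in> C" for K
  proof -
    have "set (coord K (map (val M e) ts)) \<subseteq> univ K"
      using IH(1) that by (intro coord_univ) auto
    then show ?thesis
      using structures[OF that] Fn.prems(1) by (simp add: is_structure_def)
  qed
  have rep: "uclass C U univ ?x \<in> uprod C U univ"
    "eventually (\<lambda>K. urep (uclass C U univ ?x) K = ?x K) U"
    by (rule uclass_representative(1)[OF eventually_C], erule x)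
      (rule uclass_representative(2)[OF eventually_C], erule x)
  have "eventually (\<lambda>K. \<forall>t\<in>set ts. urep (val M e t) K = val K (\<lambda>v. urep (e v) K) t) U"
    using IH(2) by (intro eventually_ball_finite) auto
  then have "eventually (\<lambda>K. urep (val M e (Fn f ts)) K = val K (\<lambda>v. urep (e v) K) (Fn f ts)) U"
    using rep(2) unfolding val by eventually_elim (simp cong: map_cong)
  with rep(1) show ?case unfolding val univ_M by simp
qed simp

lemma los:
  assumes "wf_fm L \<phi>" "\<And>v. v \<in> fv \<phi> \<Longrightarrow> e v \<in> univ M"
  shows "sat M e \<phi> \<longleftrightarrow> eventually (\<lambda>K. sat K (\<lambda>v. urep (e v) K) \<phi>) U"
  using assms
proof (induction \<phi> arbitrary: e)
  case (Eq s t)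
  have s: "val M e s \<in> univ M" "eventually (\<lambda>K. urep (val M e s) K = val K (\<lambda>v. urep (e v) K) s) U"
    using val_ultraproduct[of s e] Eq by auto
  have t: "val M e t \<in> univ M" "eventually (\<lambda>K. urep (val M e t) K = val K (\<lambda>v. urep (e v) K) t) U"
    using val_ultraproduct[of t e] Eq by auto
  have "sat M e (Eq s t) \<longleftrightarrow> eventually (\<lambda>K. urep (val M e s) K = urep (val M e t) K) U"
    using uprod_eq_iff[OF s(1)[unfolded univ_M] t(1)[unfolded univ_M]] by simp
  also have "\<dots> \<longleftrightarrow> eventually (\<lambda>K. sat K (\<lambda>v. urep (e v) K) (Eq s t)) U"
    using eventually_conj[OF s(2) t(2)] by (intro eventually_subst) (auto elim: eventually_mono)
  finally show ?case .
next
  case (Rel R ts)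
  have "eventually (\<lambda>K. \<forall>t\<in>set ts. urep (val M e t) K = val K (\<lambda>v. urep (e v) K) t) U"
  proof (intro eventually_ball_finite ballI)
    fix t assume "t \<in> set ts"
    then show "eventually (\<lambda>K. urep (val M e t) K = val K (\<lambda>v. urep (e v) K) t) U"
      using val_ultraproduct[of t e] Rel by auto
  qed simp
  then have "eventually (\<lambda>K. rl K R (coord K (map (val M e) ts)) = sat K (\<lambda>v. urep (e v) K) (Rel R ts)) U"
    by eventually_elim (simp cong: map_cong)
  then have "eventually (\<lambda>K. rl K R (coord K (map (val M e) ts))) U
    \<longleftrightarrow> eventually (\<lambda>K. sat K (\<lambda>v. urep (e v) K) (Rel R ts)) U"
    by (rule eventually_subst)
  then show ?case by (simp add: ultraproduct_def)
next
  case (Neg \<phi>)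
  then show ?case by (simp add: eventually_Not)
next
  case (Conj \<phi> \<psi>)
  then show ?case by (simp add: eventually_conj_iff)
next
  case (Exists i \<phi>)
  have IH: "sat M (e(i := a)) \<phi> \<longleftrightarrow> eventually (\<lambda>K. sat K ((\<lambda>v. urep (e v) K)(i := urep a K)) \<phi>) U"
    if "a \<in> univ M" for a
  proof -
    have eq: "(\<lambda>v. urep ((e(i := a)) v) K) = (\<lambda>v. urep (e v) K)(i := urep a K)" for K
      by (auto simp: fun_eq_iff)
    have "sat M (e(i := a)) \<phi> \<longleftrightarrow> eventually (\<lambda>K. sat K (\<lambda>v. urep ((e(i := a)) v) K) \<phi>) U"
      using Exists.prems that by (intro Exists.IH) auto
    then show ?thesis unfolding eq .
  qed
  show ?case
  proof
    assume "sat M e (Exists i \<phi>)"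
    then obtain a where a: "a \<in> univ M" "sat M (e(i := a)) \<phi>" by auto
    from a(2)[unfolded IH[OF a(1)]] eventually_C
    show "eventually (\<lambda>K. sat K (\<lambda>v. urep (e v) K) (Exists i \<phi>)) U"
      by eventually_elim (use urep_univ[OF a(1)] in auto)
  next
    assume ev: "eventually (\<lambda>K. sat K (\<lambda>v. urep (e v) K) (Exists i \<phi>)) U"
    let ?P = "\<lambda>K b. b \<in> univ K \<and> sat K ((\<lambda>v. urep (e v) K)(i := b)) \<phi>"
    \<comment> \<open>The second default keeps \<open>x K\<close> inside \<open>univ K\<close> for
      every \<open>K\<close> in \<open>C\<close>, also where no witness exists, so that
      \<open>x\<close> defines an element of the ultraproduct.\<close>
    define x where "x K = (if \<exists>b. ?P K b then SOME b. ?P K b else SOME b. b \<in> univ K)" for K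
    have x: "?P K (x K)" if "\<exists>b. ?P K b" for K
      using someI_ex[OF that] that by (simp add: x_def)
    have "x K \<in> univ K" if "K \<in> C" for K
    proof (cases "\<exists>b. ?P K b")
      case False
      have "\<exists>b. b \<in> univ K" using structures[OF that] by (auto simp: is_structure_def)
      from someI_ex[OF this] show ?thesis unfolding x_def if_not_P[OF False] .
    qed (use x in blast)
    then have rep: "uclass C U univ x \<in> uprod C U univ"
      "eventually (\<lambda>K. urep (uclass C U univ x) K = x K) U"
      using uclass_representative[of C U x univ] eventually_C by blast+
    have "eventually (\<lambda>K. sat K ((\<lambda>v. urep (e v) K)(i := urep (uclass C U univ x) K)) \<phi>) U"
      using ev rep(2)
    proof eventually_elim
      case (elim K)
      then have "\<exists>b. ?P K b" by auto
      from x[OF this] elim(2) show ?case by simp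
    qed
    then show "sat M e (Exists i \<phi>)"
      using IH[of "uclass C U univ x"] rep(1) by (auto simp: univ_M)
  qed
qed

lemma los_list:
  assumes "\<phi> \<in> formulas L (length cs)" "set cs \<subseteq> univ M"
  shows "sat M ((!) cs) \<phi> \<longleftrightarrow> eventually (\<lambda>K. sat K ((!) (coord K cs)) \<phi>) U"
proof -
  have "sat K (\<lambda>v. urep (cs ! v) K) \<phi> = sat K ((!) (coord K cs)) \<phi>" for K
    using assms(1) by (rule sat_agree) simp
  moreover have "cs ! v \<in> univ M" if "v \<in> fv \<phi>" for v
  proof -
    have "v < length cs" using assms(1) that by (auto simp: formulas_def)
    then show ?thesis using assms(2) nth_mem[of v cs] by blast
  qed
  ultimately show ?thesis using los[of \<phi> "(!) cs"] assms(1) by (simp add: formulas_def)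
qed

lemma los_solset_nonempty:
  assumes "\<phi> \<in> formulas L (n + length bs)" "set bs \<subseteq> univ M"
  shows "solset M n (\<phi>, bs) \<noteq> {} \<longleftrightarrow> eventually (\<lambda>K. solset K n (\<phi>, coord K bs) \<noteq> {}) U"
proof -
  have "sat K ((!) (coord K bs)) (exb n (length bs) \<phi>) \<longleftrightarrow> solset K n (\<phi>, coord K bs) \<noteq> {}" for K
    using sat_exb[of \<phi> L n "coord K bs" K] assms(1) by (auto simp: mem_solset)
  moreover have "sat M ((!) bs) (exb n (length bs) \<phi>) \<longleftrightarrow> solset M n (\<phi>, bs) \<noteq> {}"
    using sat_exb[of \<phi> L n bs M] assms(1) by (auto simp: mem_solset)
  ultimately show ?thesis using los_list[OF exb_formulas[OF assms(1)] assms(2)] by simp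
qed

lemma los_solset_subset:
  assumes "\<phi> \<in> formulas L (n + length as)" "\<psi> \<in> formulas L (n + length bs)"
    and "set as \<subseteq> univ M" "set bs \<subseteq> univ M" and "solset M n (\<phi>, as) \<subseteq> solset M n (\<psi>, bs)"
  shows "eventually (\<lambda>K. solset K n (\<phi>, coord K as) \<subseteq> solset K n (\<psi>, coord K bs)) U"
proof -
  let ?\<theta> = "Conj (lift n (length bs) \<phi>) (Neg \<psi>)"
  have "solset M n (?\<theta>, bs @ as) = {}" using solset_diff[OF assms(1,2), of M] assms(5) by blast
  moreover have "?\<theta> \<in> formulas L (n + length (bs @ as))"
    using meet_formulas[of \<phi> L n as "Neg \<psi>" bs] assms(1,2) by simp
  ultimately have "\<not> eventually (\<lambda>K. solset K n (?\<theta>, coord K (bs @ as)) \<noteq> {}) U"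
    using los_solset_nonempty[of ?\<theta> n "bs @ as"] assms(3,4) by simp
  then have "eventually (\<lambda>K. solset K n (?\<theta>, coord K (bs @ as)) = {}) U"
    unfolding eventually_Not[symmetric] by simp
  moreover have "solset K n (?\<theta>, coord K (bs @ as))
    = solset K n (\<phi>, coord K as) - solset K n (\<psi>, coord K bs)" for K
    using solset_diff[of \<phi> L n "coord K as" \<psi> "coord K bs" K] assms(1,2) by simp
  ultimately show ?thesis by simp
qed

text \<open>The families in \<open>N\<close> reach the finite factors through
  \<open>witness_formula\<close>, first from \<open>as\<close> to \<open>bs\<close> by equality of
  types, then by Los's theorem. There the set is finite and a family of size
  \<open>(j + 1) * k\<close> can be counted.\<close>

lemma eventually_small_instance:
  assumes "set bs \<subseteq> univ M" and t: "teq L N as M bs"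
    and \<phi>: "\<phi> \<in> formulas L (n + length as)" and \<psi>: "\<psi> \<in> formulas L (n + length c)"
    and k: "k > 0" and div: "fdiv L N as n \<psi> c k"
    and \<chi>: "\<chi> \<in> formulas L (length c + length as)" "sat N ((!) (c @ as)) \<chi>"
  shows "eventually (\<lambda>K. \<exists>d\<in>tuples K (length c). sat K ((!) (d @ coord K bs)) \<chi> \<and>
    Suc j * card (solset K n (\<phi>, coord K bs) \<inter> solset K n (\<psi>, d))
      \<le> card (solset K n (\<phi>, coord K bs))) U"
proof -
  let ?s = "length c"
  let ?m = "Suc j * k"
  have l: "length bs = length as" using t by (rule teq_length)
  have \<chi>': "\<chi> \<in> formulas L (?s + length bs)" using \<chi>(1) l by simp
  have "has_family N as n ?s \<chi> \<psi> k ?m" using div \<chi> by (simp add: fdiv_def)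
  then have "has_family M bs n ?s \<chi> \<psi> k ?m" using teq_has_family[OF t \<chi>(1) \<psi>] by simp
  then have "sat M ((!) bs) (witness_formula n ?s (length bs) \<chi> \<psi> k ?m)"
    using witness_formula(2)[OF \<chi>' \<psi>] by blast
  then have "eventually (\<lambda>K. sat K ((!) (coord K bs)) (witness_formula n ?s (length bs) \<chi> \<psi> k ?m)) U"
    using los_list[OF witness_formula(1)[OF \<chi>' \<psi>] assms(1)] by blast
  then show ?thesis
    using eventually_C
  proof eventually_elim
    case (elim K)
    have \<chi>K: "\<chi> \<in> formulas L (?s + length (coord K bs))" using \<chi>' by simp
    have "has_family K (coord K bs) n ?s \<chi> \<psi> k ?m"
      using elim(1) witness_formula(2)[OF \<chi>K \<psi>, of K k ?m] by simp
    then obtain cs where cs: "\<And>i. i < ?m \<Longrightarrow> cs i \<in> tuples K ?s"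
      "\<And>i. i < ?m \<Longrightarrow> sat K ((!) (cs i @ coord K bs)) \<chi>" "kinconsistent K n \<psi> k ?m cs"
      unfolding has_family_def by blast
    have sub: "solset K n (\<phi>, coord K bs) \<subseteq> tuples K n" by (auto simp: mem_solset)
    moreover have "finite (tuples K n)" using structures[OF elim(2)] by (intro finite_tuples) simp
    ultimately have "finite (solset K n (\<phi>, coord K bs))" by (rule finite_subset)
    from count_kinconsistent[OF cs(3) k this sub] cs show ?case by blast
  qed
qed

text \<open>Saturation of the ultraproduct for the countably many conditions that the new parameters have
  a given type and cut the cardinality down by more than any finite factor.\<close>

lemma dividing_instance_drops:
  assumes ctble: "countable_language L" and bs: "set bs \<subseteq> univ M" and t: "teq L N as M bs"
    and \<phi>: "\<phi> \<in> formulas L (n + length as)" and \<psi>: "\<psi> \<in> formulas L (n + length c)"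
    and k: "k > 0" and div: "fdiv L N as n \<psi> c k"
  obtains c' where "c' \<in> tuples M (length c)" "teq L N (c @ as) M (c' @ bs)"
    "\<And>j. eventually (\<lambda>K. Suc j * card (solset K n (\<phi>, coord K bs) \<inter> solset K n (\<psi>, coord K c'))
      \<le> card (solset K n (\<phi>, coord K bs))) U"
proof -
  let ?s = "length c"
  have l: "length bs = length as" using t by (rule teq_length)
  define T where "T = {\<chi> \<in> formulas L (?s + length as). sat N ((!) (c @ as)) \<chi>}"
  have "countable T"
    by (rule countable_subset[OF _ countable_formulas[OF ctble, of "?s + length as"]]) (auto simp: T_def)
  moreover have "truth \<in> T" by (simp add: T_def)
  ultimately obtain \<chi> :: "nat \<Rightarrow> ('f, 'r) fm" where \<chi>: "range \<chi> = T"
    using range_from_nat_into[of T] by blast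
  have \<chi>T: "\<chi> i \<in> formulas L (?s + length as)" "sat N ((!) (c @ as)) (\<chi> i)" for i
    using \<chi> by (auto simp: T_def)
  \<comment> \<open>Condition \<open>j\<close> bundles the first \<open>j + 1\<close> formulas of
    the type with the factor \<open>j + 1\<close>: the conditions decrease in \<open>j\<close>, and
    each involves a single conjunction.\<close>
  define G where "G K j d \<longleftrightarrow> (\<forall>i\<le>j. sat K ((!) (d @ coord K bs)) (\<chi> i)) \<and>
    Suc j * card (solset K n (\<phi>, coord K bs) \<inter> solset K n (\<psi>, d))
      \<le> card (solset K n (\<phi>, coord K bs))" for K j d
  have anti: "G K i d" if "G K j d" "i \<le> j" for K i j d
  proof -
    let ?x = "card (solset K n (\<phi>, coord K bs) \<inter> solset K n (\<psi>, d))"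
    have "Suc i * ?x \<le> Suc j * ?x" using that(2) by (intro mult_le_mono1) simp
    then show ?thesis using that unfolding G_def by (meson le_trans)
  qed
  have G: "eventually (\<lambda>K. \<exists>d\<in>tuples K ?s. G K j d) U" for j
  proof -
    let ?b = "bigand (\<chi> ` {..j})"
    have "?b \<in> formulas L (?s + length as)" using \<chi>T(1) by (intro bigand_formulas) auto
    moreover have "sat N ((!) (c @ as)) ?b" using \<chi>T(2) by (auto simp: sat_bigand)
    ultimately have "eventually (\<lambda>K. \<exists>d\<in>tuples K ?s. sat K ((!) (d @ coord K bs)) ?b \<and>
      Suc j * card (solset K n (\<phi>, coord K bs) \<inter> solset K n (\<psi>, d))
        \<le> card (solset K n (\<phi>, coord K bs))) U"
      by (rule eventually_small_instance[OF bs t \<phi> \<psi> k div])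
    then show ?thesis by (rule eventually_mono) (auto simp: G_def sat_bigand)
  qed
  have "\<exists>d\<in>tuples K ?s. \<forall>j. (\<exists>d'\<in>tuples K ?s. G K j d') \<longrightarrow> G K j d" if K: "K \<in> C" for K
  proof (rule finite_diagonal)
    show "finite (tuples K ?s)" using structures[OF K] by (intro finite_tuples) simp
    obtain a where "a \<in> univ K" using structures[OF K] by (auto simp: is_structure_def)
    then have "replicate ?s a \<in> tuples K ?s" by (auto simp: tuples_def)
    then show "tuples K ?s \<noteq> {}" by blast
  qed (rule anti)
  then obtain d where d: "\<And>K. K \<in> C \<Longrightarrow> d K \<in> tuples K ?s"
    "\<And>K j. K \<in> C \<Longrightarrow> \<exists>d'\<in>tuples K ?s. G K j d' \<Longrightarrow> G K j (d K)" by metis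
  \<comment> \<open>The choice of \<open>d K\<close> does not depend on \<open>j\<close>, while the
    exceptional set of factors may. Each condition is attainable at almost every \<open>K\<close>,
    hence met by \<open>d K\<close> there.\<close>
  have Gd: "eventually (\<lambda>K. G K j (d K)) U" for j
    using G[of j] eventually_C by eventually_elim (rule d(2))
  define c' where "c' = map (\<lambda>i. uclass C U univ (\<lambda>K. d K ! i)) [0..<?s]"
  have "d K ! i \<in> univ K" if "K \<in> C" "i < ?s" for K i
    using d(1)[OF that(1)] that(2) nth_mem[of i "d K"] by (auto simp: tuples_def)
  then have rep: "uclass C U univ (\<lambda>K. d K ! i) \<in> univ M"
    "eventually (\<lambda>K. urep (uclass C U univ (\<lambda>K. d K ! i)) K = d K ! i) U" if "i < ?s" for i
    using uclass_representative[OF eventually_C, of "\<lambda>K. d K ! i" univ] that by (auto simp: univ_M)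
  have c'M: "set c' \<subseteq> univ M" using rep(1) by (auto simp: c'_def)
  have "eventually (\<lambda>K. \<forall>i\<in>{..<?s}. urep (uclass C U univ (\<lambda>K. d K ! i)) K = d K ! i) U"
    using rep(2) by (intro eventually_ball_finite) auto
  then have coord: "eventually (\<lambda>K. coord K c' = d K) U"
    using eventually_C
  proof eventually_elim
    case (elim K)
    then show ?case using tuples_length[OF d(1)[OF elim(2)]] by (intro nth_equalityI) (auto simp: c'_def)
  qed
  have Gc: "eventually (\<lambda>K. G K j (coord K c')) U" for j
    using Gd[of j] coord by eventually_elim simp
  have c't: "c' \<in> tuples M ?s" using c'M by (intro tuplesI) (simp_all add: c'_def)
  have lc: "length c' = ?s" using c't by (rule tuples_length)
  have "teq L N (c @ as) M (c' @ bs)"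
  proof (rule teq_of_subtype)
    fix \<theta> assume "\<theta> \<in> formulas L (length (c @ as))" "sat N ((!) (c @ as)) \<theta>"
    then have "\<theta> \<in> T" by (simp add: T_def)
    then obtain j where j: "\<theta> = \<chi> j" using \<chi> by blast
    have "eventually (\<lambda>K. sat K ((!) (coord K (c' @ bs))) \<theta>) U"
      using Gc[of j] by eventually_elim (simp add: G_def j)
    moreover have "\<theta> \<in> formulas L (length (c' @ bs))" using \<chi>T(1) by (simp add: j lc l)
    ultimately show "sat M ((!) (c' @ bs)) \<theta>" using los_list[of \<theta> "c' @ bs"] c'M bs by simp
  qed (simp add: lc l)
  moreover have "eventually (\<lambda>K. Suc j * card (solset K n (\<phi>, coord K bs) \<inter> solset K n (\<psi>, coord K c'))
      \<le> card (solset K n (\<phi>, coord K bs))) U" for j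
    using Gc[of j] by eventually_elim (simp only: G_def)
  ultimately show thesis using that c't by blast
qed

section \<open>Pseudofinite dimension\<close>

lemma hclass_representative:
  "hclass C U f \<in> hyperreals C U" "eventually (\<lambda>K. urep (hclass C U f) K = f K) U"
  unfolding hyperreals_def by (rule uclass_representative[OF eventually_C]; simp)+

lemma hint_representative: "eventually (\<lambda>K. urep (hint C U k) K = of_int k) U"
  unfolding hint_def by (rule hclass_representative(2))

lemma hint_conv_int: "hint C U k \<in> conv_int C U"
proof -
  have "hle U (hint C U k) (hint C U k)" by (simp add: hle_def)
  moreover have "hint C U k \<in> hyperreals C U" unfolding hint_def by (rule hclass_representative(1))
  ultimately show ?thesis unfolding conv_int_def by blast
qed

abbreviation fin_card :: "nat \<Rightarrow> ('f, 'r, ('f, 'r, 'a) uelem) pfm \<Rightarrow> ('f, 'r, 'a) fostruct \<Rightarrow> nat" where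
  "fin_card n D K \<equiv> card (solset K n (fst D, coord K (snd D)))"

abbreviation log_card :: "nat \<Rightarrow> ('f, 'r, ('f, 'r, 'a) uelem) pfm \<Rightarrow> ('f, 'r, 'a) hyper" where
  "log_card n D \<equiv> hlog C U (fcard C U n (fst D) (snd D))"

lemma log_card_representative:
  "log_card n D \<in> hyperreals C U"
  "eventually (\<lambda>K. urep (log_card n D) K = ln (real (fin_card n D K))) U"
proof -
  show "log_card n D \<in> hyperreals C U" unfolding hlog_def by (rule hclass_representative(1))
  have "eventually (\<lambda>K. urep (fcard C U n (fst D) (snd D)) K = real (fin_card n D K)) U"
    unfolding fcard_def by (rule hclass_representative(2))
  moreover have "eventually (\<lambda>K. urep (log_card n D) K = ln (urep (fcard C U n (fst D) (snd D)) K)) U"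
    unfolding hlog_def by (rule hclass_representative(2))
  ultimately show "eventually (\<lambda>K. urep (log_card n D) K = ln (real (fin_card n D K))) U"
    by eventually_elim simp
qed

lemma hadd_representative: "eventually (\<lambda>K. urep (hadd C U a b) K = urep a K + urep b K) U"
  unfolding hadd_def by (rule hclass_representative(2))

lemma fin_card_pos:
  assumes "D \<in> pformulas L (univ M) n" "solset M n D \<noteq> {}"
  shows "eventually (\<lambda>K. fin_card n D K > 0) U"
proof -
  obtain \<phi> bs where D: "D = (\<phi>, bs)" by (cases D)
  have "eventually (\<lambda>K. solset K n (\<phi>, coord K bs) \<noteq> {}) U"
    using los_solset_nonempty[of \<phi> n bs] assms by (simp add: D pformulas_iff)
  then show ?thesis
    using eventually_C
  proof eventually_elim
    case (elim K)
    have "solset K n (\<phi>, coord K bs) \<subseteq> tuples K n" by (auto simp: mem_solset)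
    moreover have "finite (tuples K n)" using structures[OF elim(2)] by (intro finite_tuples) simp
    ultimately have "finite (solset K n (\<phi>, coord K bs))" by (rule finite_subset)
    then show ?case using elim(1) by (simp add: D card_gt_0_iff)
  qed
qed

lemma fin_card_mono:
  assumes "D \<in> pformulas L (univ M) n" "E \<in> pformulas L (univ M) n" "solset M n D \<subseteq> solset M n E"
  shows "eventually (\<lambda>K. fin_card n D K \<le> fin_card n E K) U"
proof -
  obtain \<phi> as \<psi> bs where DE: "D = (\<phi>, as)" "E = (\<psi>, bs)" by (cases D, cases E)
  have "eventually (\<lambda>K. solset K n (\<phi>, coord K as) \<subseteq> solset K n (\<psi>, coord K bs)) U"
    using assms by (intro los_solset_subset) (auto simp: DE pformulas_iff)
  then show ?thesis
    using eventually_C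
  proof eventually_elim
    case (elim K)
    have "solset K n (\<psi>, coord K bs) \<subseteq> tuples K n" by (auto simp: mem_solset)
    moreover have "finite (tuples K n)" using structures[OF elim(2)] by (intro finite_tuples) simp
    ultimately have "finite (solset K n (\<psi>, coord K bs))" by (rule finite_subset)
    then show ?case using elim(1) by (simp add: DE card_mono)
  qed
qed

lemma delta_nonempty:
  assumes "D \<in> pformulas L (univ M) n" "solset M n D \<noteq> {}"
  shows "delta C U n D = cut_of C U (hcoset C U (log_card n D))"
proof -
  have "fcard C U n (fst D) (snd D) \<noteq> hint C U 0"
  proof
    assume *: "fcard C U n (fst D) (snd D) = hint C U 0"
    have "eventually (\<lambda>K. urep (fcard C U n (fst D) (snd D)) K = real (fin_card n D K)) U"
      unfolding fcard_def by (rule hclass_representative(2))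
    then have "eventually (\<lambda>_. False) U"
      using hint_representative[of 0] fin_card_pos[OF assms] by eventually_elim (simp add: *)
    then show False using eventually_False by simp
  qed
  then show ?thesis by (simp add: delta_def case_prod_unfold)
qed

text \<open>Cuts are sets, so comparisons of dimensions become membership: the coset of the
  logarithm of one cardinality is tested against the cut of another set. This is the positive half,
  from inclusion.\<close>

lemma log_card_in_delta:
  assumes "D \<in> pformulas L (univ M) n" "E \<in> pformulas L (univ M) n"
    and "solset M n D \<noteq> {}" "solset M n D \<subseteq> solset M n E"
  shows "hcoset C U (log_card n D) \<in> delta C U n E"
proof -
  \<comment> \<open>A coset consists of sums with elements of the convex hull, so its evident
    representative is taken as the sum with zero.\<close>
  have mem: "hadd C U (log_card n F) (hint C U 0) \<in> hcoset C U (log_card n F)" for F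
    unfolding hcoset_def using hint_conv_int by blast
  have "hle U (hadd C U (log_card n D) (hint C U 0)) (hadd C U (log_card n E) (hint C U 0))"
    unfolding hle_def
    using hadd_representative[of "log_card n D" "hint C U 0"]
      hadd_representative[of "log_card n E" "hint C U 0"]
      log_card_representative(2)[of n D] log_card_representative(2)[of n E]
      fin_card_mono[OF assms(1,2,4)] fin_card_pos[OF assms(1,3)]
    by eventually_elim simp
  then have "qle U (hcoset C U (log_card n D)) (hcoset C U (log_card n E))"
    unfolding qle_def using mem by blast
  moreover have "hcoset C U (log_card n D) \<in> hquot C U"
    unfolding hquot_def using log_card_representative(1) by blast
  moreover have "solset M n E \<noteq> {}" using assms(3,4) by blast
  ultimately show ?thesis using delta_nonempty[OF assms(2)] by (simp add: cut_of_def)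
qed

text \<open>Membership would give \<open>ln |D| + u \<le> ln |E| + v\<close> with \<open>u\<close>
  and \<open>v\<close> bounded by integers \<open>a\<close> from below and \<open>b\<close> from
  above, hence \<open>|D| \<le> exp (b - a) * |E|\<close> almost everywhere. A drop by the factor
  \<open>j + 1\<close> with \<open>j > exp (b - a)\<close> contradicts this.\<close>

lemma log_card_not_in_delta:
  assumes "D \<in> pformulas L (univ M) n" "E \<in> pformulas L (univ M) n" "solset M n E \<noteq> {}"
    and drop: "\<And>j. eventually (\<lambda>K. Suc j * fin_card n E K \<le> fin_card n D K) U"
  shows "hcoset C U (log_card n D) \<notin> delta C U n E"
proof
  assume "hcoset C U (log_card n D) \<in> delta C U n E"
  then have "qle U (hcoset C U (log_card n D)) (hcoset C U (log_card n E))"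
    using delta_nonempty[OF assms(2,3)] by (simp add: cut_of_def)
  then obtain u v where uv: "u \<in> conv_int C U" "v \<in> conv_int C U"
    "hle U (hadd C U (log_card n D) u) (hadd C U (log_card n E) v)"
    unfolding qle_def hcoset_def by blast
  obtain a where a: "hle U (hint C U a) u" using uv(1) by (auto simp: conv_int_def)
  obtain b where b: "hle U v (hint C U b)" using uv(2) by (auto simp: conv_int_def)
  obtain j :: nat where j: "exp (of_int b - of_int a) < real j" using reals_Archimedean2 by blast
  have "eventually (\<lambda>_. False) U"
    using uv(3)[unfolded hle_def] a[unfolded hle_def] b[unfolded hle_def] drop[of j]
      hint_representative[of a] hint_representative[of b]
      hadd_representative[of "log_card n D" u] hadd_representative[of "log_card n E" v]
      log_card_representative(2)[of n D] log_card_representative(2)[of n E]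
      fin_card_pos[OF assms(2,3)]
  proof eventually_elim
    case (elim K)
    let ?x = "real (fin_card n D K)" and ?y = "real (fin_card n E K)"
    have y: "?y > 0" using elim by simp
    have "real (Suc j * fin_card n E K) \<le> ?x" using elim(4) by (simp only: of_nat_le_iff)
    then have xy: "real (Suc j) * ?y \<le> ?x" by (simp only: of_nat_mult)
    have "ln (real (Suc j)) + ln ?y = ln (real (Suc j) * ?y)" using y by (simp add: ln_mult)
    also have "\<dots> \<le> ln ?x" using xy y by (intro ln_mono) auto
    finally have "ln (real (Suc j)) + ln ?y \<le> ln ?x" .
    moreover have "ln ?x + of_int a \<le> ln ?y + of_int b" using elim by linarith
    ultimately have "ln (real (Suc j)) \<le> of_int b - of_int a" by linarith
    then have "exp (ln (real (Suc j))) \<le> exp (of_int b - of_int a)" by (simp only: exp_le_cancel_iff)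
    then have "real (Suc j) \<le> exp (of_int b - of_int a)"
      by (simp only: exp_ln of_nat_0_less_iff zero_less_Suc)
    with j show False by simp
  qed
  then show False using eventually_False by simp
qed

text \<open>A finite part \<open>q\<close> of the chain is implied by some \<open>D m\<close>, so
  the coset of \<open>D m\<close> lies in the cut of every set entailed by \<open>q\<close>. If
  \<open>q\<close> had the dimension of the whole chain, this coset would also lie in the cut of
  \<open>D (Suc m)\<close>, which the drop at \<open>m\<close> forbids.\<close>

lemma SA_no_descent:
  assumes SA: "SA L C U"
    and D: "\<And>i :: nat. D i \<in> pformulas L (univ M) n" "\<And>i. solset M n (D i) \<noteq> {}"
    and sub: "\<And>i. solset M n (D (Suc i)) \<subseteq> solset M n (D i)"
    and drop: "\<And>i j. eventually (\<lambda>K. Suc j * fin_card n (D (Suc i)) K \<le> fin_card n (D i) K) U"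
  shows False
proof -
  have anti: "solset M n (D j) \<subseteq> solset M n (D i)" if "i \<le> j" for i j
    using lift_Suc_antimono_le[of "\<lambda>i. solset M n (D i)", OF sub that] .
  have bound: "\<exists>m. solset M n (D m) \<subseteq> realizations M n q" if q: "finite q" "q \<subseteq> range D" for q
  proof -
    obtain I where I: "finite I" "q = D ` I" using finite_subset_image[OF q] by blast
    obtain m where m: "\<And>i. i \<in> I \<Longrightarrow> i \<le> m" using I(1) by (metis finite_nat_set_iff_bounded_le)
    have "solset M n (D m) \<subseteq> realizations M n q"
    proof
      fix xs assume xs: "xs \<in> solset M n (D m)"
      then have "xs \<in> tuples M n" by (cases "D m") (simp add: mem_solset)
      moreover have "xs \<in> solset M n (D i)" if "i \<in> I" for i
        using anti[OF m[OF that]] xs by blast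
      ultimately show "xs \<in> realizations M n q" by (simp add: realizations_def I(2))
    qed
    then show ?thesis by blast
  qed
  have "partial_type L M (univ M) n (range D)"
    unfolding partial_type_def
  proof (intro conjI allI impI)
    show "range D \<subseteq> pformulas L (univ M) n" using D(1) by blast
    fix q assume "finite q \<and> q \<subseteq> range D"
    then show "realizations M n q \<noteq> {}" using bound[of q] D(2) by blast
  qed
  then obtain q where q: "finite q" "q \<subseteq> range D" "delta_type L C U n (range D) = delta_type L C U n q"
    using SA unfolding SA_def by (metis order_refl)
  obtain m where m: "solset M n (D m) \<subseteq> realizations M n q" using bound[OF q(1,2)] by blast
  have "hcoset C U (log_card n (D m)) \<in> delta_type L C U n q"
    unfolding delta_type_def Let_def
  proof (rule InterI)
    fix X assume "X \<in> {delta C U n E |E. E \<in> pformulas L (univ M) n \<and> entails M n q (solset M n E)}"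
    then obtain E where E: "X = delta C U n E" "E \<in> pformulas L (univ M) n"
      "entails M n q (solset M n E)" by blast
    then obtain q' where "q' \<subseteq> q" "realizations M n q' \<subseteq> solset M n E"
      by (auto simp: entails_def)
    moreover from this(1) have "realizations M n q \<subseteq> realizations M n q'"
      by (auto simp: realizations_def)
    ultimately have "solset M n (D m) \<subseteq> solset M n E" using m by blast
    then show "hcoset C U (log_card n (D m)) \<in> X"
      unfolding E(1) by (rule log_card_in_delta[OF D(1) E(2) D(2)])
  qed
  moreover have "delta_type L C U n (range D) \<subseteq> delta C U n (D (Suc m))"
  proof -
    have "realizations M n {D (Suc m)} \<subseteq> solset M n (D (Suc m))" by (auto simp: realizations_def)
    then have "entails M n (range D) (solset M n (D (Suc m)))"
      unfolding entails_def by (intro exI[of _ "{D (Suc m)}"]) auto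
    then show ?thesis unfolding delta_type_def Let_def using D(1) by blast
  qed
  ultimately have "hcoset C U (log_card n (D m)) \<in> delta C U n (D (Suc m))" using q(3) by blast
  then show False using log_card_not_in_delta[OF D(1) D(1) D(2) drop] by blast
qed

text \<open>Two chains run in parallel. The rank in \<open>N\<close> selects the next dividing
  instance; a tuple of the same type in \<open>M\<close> is then chosen so that the cardinality
  drops. Keeping the types equal is enough to continue, since \<open>dividing_instance_drops\<close>
  uses dividing in \<open>N\<close> over \<open>as\<close> and only the type of
  \<open>bs\<close>.\<close>

lemma tuples_small:
  assumes "countable_language L" "SA L C U" and t: "teq L N [] M []"
  shows "tuples N n \<in> small L N n"
proof (rule ccontr)
  assume large: "tuples N n \<notin> small L N n"
  \<comment> \<open>The state consists of a formula with its parameters in \<open>N\<close> and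
    their copies in \<open>M\<close>. The index serves only the shape of
    \<open>dependent_nat_choice\<close>.\<close>
  let ?P = "\<lambda>(i :: nat) (\<phi>, as, bs). \<phi> \<in> formulas L (n + length as) \<and> set as \<subseteq> univ N \<and>
    set bs \<subseteq> univ M \<and> teq L N as M bs \<and> solset N n (\<phi>, as) \<notin> small L N n"
  let ?Q = "\<lambda>(i :: nat) (\<phi>, as, bs) (\<phi>', as' :: 'd list, bs'). solset M n (\<phi>', bs') \<subseteq> solset M n (\<phi>, bs) \<and>
    (\<forall>j. eventually (\<lambda>K. Suc j * fin_card n (\<phi>', bs') K \<le> fin_card n (\<phi>, bs) K) U)"
  have "\<exists>s. \<forall>i. ?P i (s i) \<and> ?Q i (s i) (s (Suc i))"
  proof (rule dependent_nat_choice)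
    have "solset N n (truth, []) = tuples N n" by (auto simp: mem_solset)
    then have "?P 0 (truth, [], [])" using t large by simp
    then show "\<exists>x. ?P 0 x" by blast
    fix x i assume x: "?P i x"
    obtain \<phi> as bs where x_eq: "x = (\<phi>, as, bs)" by (cases x)
    have \<phi>: "\<phi> \<in> formulas L (n + length as)" and as: "set as \<subseteq> univ N" and bs: "set bs \<subseteq> univ M"
      and t: "teq L N as M bs" and l: "solset N n (\<phi>, as) \<notin> small L N n"
      using x by (simp_all add: x_eq)
    have lbs: "length bs = length as" using t by (rule teq_length)
    obtain \<psi> c k where c: "set c \<subseteq> univ N" "\<psi> \<in> formulas L (n + length c)" "k > 0"
      "fdiv L N as n \<psi> c k" "solset N n (\<phi>, as) \<inter> solset N n (\<psi>, c) \<notin> small L N n"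
      using not_small(2)[OF l as] by blast
    obtain c' where c': "c' \<in> tuples M (length c)" "teq L N (c @ as) M (c' @ bs)"
      "\<And>j. eventually (\<lambda>K. Suc j * card (solset K n (\<phi>, coord K bs) \<inter> solset K n (\<psi>, coord K c'))
        \<le> card (solset K n (\<phi>, coord K bs))) U"
      using dividing_instance_drops[OF assms(1) bs t \<phi> c(2-4)] by blast
    have lc: "length c' = length c" using c'(1) by (rule tuples_length)
    let ?\<theta> = "Conj (lift n (length c) \<phi>) \<psi>"
    have \<theta>M: "solset M n (?\<theta>, c' @ bs) = solset M n (\<phi>, bs) \<inter> solset M n (\<psi>, c')"
      using solset_meet[of \<phi> L n bs \<psi> c' M] \<phi> c(2) lc lbs by simp
    have \<theta>K: "solset K n (?\<theta>, coord K (c' @ bs)) = solset K n (\<phi>, coord K bs) \<inter> solset K n (\<psi>, coord K c')"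
      for K
      using solset_meet[of \<phi> L n "coord K bs" \<psi> "coord K c'" K] \<phi> c(2) lc lbs by simp
    have "?P (Suc i) (?\<theta>, c @ as, c' @ bs)"
      using meet_formulas[OF \<phi> c(2)] c as bs c'(2) tuples_append[OF c'(1) bs]
        solset_meet[OF \<phi> c(2), of N] by simp
    moreover have "?Q i x (?\<theta>, c @ as, c' @ bs)"
      using c'(3) \<theta>M unfolding x_eq by (simp only: prod.case fst_conv snd_conv \<theta>K) blast
    ultimately show "\<exists>y. ?P (Suc i) y \<and> ?Q i x y" by blast
  qed
  then obtain s where s: "\<forall>i. ?P i (s i) \<and> ?Q i (s i) (s (Suc i))" ..
  define D where "D i = (fst (s i), snd (snd (s i)))" for i
  show False
  proof (rule SA_no_descent[OF assms(2), of D n])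
    fix i
    obtain \<phi> as bs where si: "s i = (\<phi>, as, bs)" by (cases "s i")
    obtain \<phi>' as' bs' where si': "s (Suc i) = (\<phi>', as', bs')" by (cases "s (Suc i)")
    have P: "\<phi> \<in> formulas L (n + length as)" "set as \<subseteq> univ N" "set bs \<subseteq> univ M" "teq L N as M bs"
      "solset N n (\<phi>, as) \<notin> small L N n" using s[THEN spec, of i] by (simp_all add: si)
    show "D i \<in> pformulas L (univ M) n"
      using P teq_length[OF P(4)] by (simp add: D_def si pformulas_iff)
    show "solset M n (D i) \<noteq> {}"
      using teq_solset_empty[OF P(4,1)] not_small(1)[OF P(5,2)] by (simp add: D_def si)
    show "solset M n (D (Suc i)) \<subseteq> solset M n (D i)"
      using s[THEN spec, of i] by (simp add: D_def si si')
    show "eventually (\<lambda>K. Suc j * fin_card n (D (Suc i)) K \<le> fin_card n (D i) K) U" for j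
      using s[THEN spec, of i] by (simp add: D_def si si')
  qed
qed

end

text \<open>The theory of \<open>M\<close> is complete: the truth value of a sentence does not
  depend on the assignment, so the sentence or its negation belongs to it.\<close>

lemma teq_Th:
  assumes "models L N (Th L M)"
  shows "teq L N [] M []"
  unfolding teq_def
proof (intro conjI ballI)
  fix \<chi> :: "('a, 'b) fm" assume "\<chi> \<in> formulas L (length [])"
  then have \<chi>: "wf_fm L \<chi>" "fv \<chi> = {}" by (auto simp: formulas_def)
  have "sat M e \<chi> = sat M e' \<chi>" for e e' by (rule sat_cong) (simp add: \<chi>)
  then have "\<chi> \<in> Th L M \<or> Neg \<chi> \<in> Th L M" using \<chi> by (auto simp: Th_def)
  then have "(\<chi> \<in> Th L M \<and> sat N ((!) []) \<chi>) \<or> (Neg \<chi> \<in> Th L M \<and> \<not> sat N ((!) []) \<chi>)"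
    using assms unfolding models_def by (metis sat.simps(3))
  then show "sat N ((!) []) \<chi> = sat M ((!) []) \<chi>" by (auto simp: Th_def)
qed simp

theorem theorem3p15:
  fixes L :: "('f, 'r) language"
    and C :: "('f, 'r, 'a) fostruct set"
    and U :: "('f, 'r, 'a) fostruct filter"
  assumes "countable_language L"
    and "infinite C"
    and "\<And>N. N \<in> C \<Longrightarrow> is_structure L N \<and> finite (univ N)"
    and "ultrafilter_on C U" and "nonprincipal_on C U"
    and "SA L C U"
  shows "supersimple L (Th L (ultraproduct C U)) TYPE('b)"
  unfolding supersimple_def
proof (intro allI impI)
  interpret finite_ultraproduct L C U by unfold_locales (fact assms)+
  fix N :: "('f, 'r, 'b) fostruct" and B n p
  assume *: "models L N (Th L M) \<and> B \<subseteq> univ N \<and> saturated_for L N B \<and> complete_type L N B n p"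
  show "\<exists>A. finite A \<and> A \<subseteq> B \<and> \<not> forks L N A n p"
  proof (rule ccontr)
    assume "\<not> ?thesis"
    then have "forks L N A n p" if "finite A" "A \<subseteq> B" for A using that by blast
    moreover have "partial_type L N B n p" using * by (simp add: complete_type_def)
    moreover have "omega_saturated L N" using * by (blast intro: saturated_for_omega)
    \<comment> \<open>The rank is computed in \<open>N\<close> itself, where the forking takes
      place; \<open>M\<close> and (SA) enter only through the contradicting
      \<open>tuples_small\<close>.\<close>
    ultimately have "tuples N n \<notin> small L N n" using * by (intro forking_not_small[of L N B n p]) auto
    with tuples_small[OF assms(1,6) teq_Th] * show False by blast
  qed
qed

end
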